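(* Let $\Omega\Subset\mathbb R^n$ be a bounded open set with smooth $p$-convex boundary ($1\le p\le n$) and let $r\in C^\infty(\overline\Omega)$ be a defining function for $\Omega$ (i.e. $r<0$ in $\Omega$, $r=0$ and $\nabla r\neq0$ on $\partial\Omega$). Then for every strictly $p$-plurisubharmonic function $\varphi\in C^\infty(\overline\Omega)$ there exist constants $K>0$ and $\eta_0\in(0,1)$ such that for every $\eta\in(0,\eta_0)$ the function $\rho:=-(-re^{-K\varphi})^\eta$ is strictly $p$-plurisubharmonic on $\Omega$.
   Context: On $\mathbb R^n$ with the Euclidean metric: a symmetric matrix is $p$-positive definite (resp. semi-definite) if the sum of any $p$ of its eigenvalues (with multiplicity) is positive (resp. nonnegative); a $C^2$ function is $p$-plurisubharmonic (resp. strictly) on a set if its Hessian matrix is $p$-positive semi-definite (resp. definite) at every point of the set. The boundary $\partial\Omega$ is $p$-convex if $\mathrm{tr}_W II_x\ge0$ for every $x\in\partial\Omega$ and every $p$-dimensional subspace $W\subseteq T_x\partial\Omega$, where $II(X,Y)=\langle D_XY,\nu\rangle$ is the second fundamental form with respect to the inward unit normal $\nu$. *)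

theory Defs
  imports "HOL-Analysis.Analysis" "HOL-Computational_Algebra.Polynomial"
begin

fun pd :: "'n::finite list \<Rightarrow> (real ^ 'n \<Rightarrow> real) \<Rightarrow> (real ^ 'n \<Rightarrow> real)" where
  "pd [] f = f"
| "pd (i # is) f = (\<lambda>x. frechet_derivative (pd is f) (at x) (axis i 1))"

definition smooth_on :: "(real ^ 'n::finite) set \<Rightarrow> (real ^ 'n \<Rightarrow> real) \<Rightarrow> bool" where
  "smooth_on U f \<longleftrightarrow> open U \<and> (\<forall>is. pd is f differentiable_on U)"

definition smooth_on_closure :: "(real ^ 'n::finite) set \<Rightarrow> (real ^ 'n \<Rightarrow> real) \<Rightarrow> bool" where
  "smooth_on_closure \<Omega> f \<longleftrightarrow> (\<exists>U. closure \<Omega> \<subseteq> U \<and> smooth_on U f)"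

definition grad :: "(real ^ 'n::finite \<Rightarrow> real) \<Rightarrow> real ^ 'n \<Rightarrow> real ^ 'n" where
  "grad f x = (\<chi> i. pd [i] f x)"

definition hessian :: "(real ^ 'n::finite \<Rightarrow> real) \<Rightarrow> real ^ 'n \<Rightarrow> real ^ 'n ^ 'n" where
  "hessian f x = (\<chi> i j. pd [i, j] f x)"

definition char_poly :: "real ^ 'n ^ 'n \<Rightarrow> real poly" where
  "char_poly A = det (\<chi> i j. (if i = j then [:0, 1:] else 0) - [:A $ i $ j:])"

text \<open>Multiset of (real) eigenvalues, counted with algebraic multiplicity.
  For symmetric matrices all eigenvalues are real.\<close>
definition eigenvalues :: "real ^ 'n ^ 'n \<Rightarrow> real multiset" where
  "eigenvalues A = proots (char_poly A)"

definition p_pos_def :: "nat \<Rightarrow> real ^ 'n ^ 'n \<Rightarrow> bool" where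
  "p_pos_def p A \<longleftrightarrow> transpose A = A \<and>
     (\<forall>M. M \<subseteq># eigenvalues A \<and> size M = p \<longrightarrow> sum_mset M > 0)"

definition p_pos_semidef :: "nat \<Rightarrow> real ^ 'n ^ 'n \<Rightarrow> bool" where
  "p_pos_semidef p A \<longleftrightarrow> transpose A = A \<and>
     (\<forall>M. M \<subseteq># eigenvalues A \<and> size M = p \<longrightarrow> sum_mset M \<ge> 0)"

definition strictly_p_psh_on :: "nat \<Rightarrow> (real ^ 'n::finite) set \<Rightarrow> (real ^ 'n \<Rightarrow> real) \<Rightarrow> bool" where
  "strictly_p_psh_on p S f \<longleftrightarrow> (\<forall>x\<in>S. p_pos_def p (hessian f x))"

definition p_psh_on :: "nat \<Rightarrow> (real ^ 'n::finite) set \<Rightarrow> (real ^ 'n \<Rightarrow> real) \<Rightarrow> bool" where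
  "p_psh_on p S f \<longleftrightarrow> (\<forall>x\<in>S. p_pos_semidef p (hessian f x))"

definition defining_function :: "(real ^ 'n::finite) set \<Rightarrow> (real ^ 'n \<Rightarrow> real) \<Rightarrow> bool" where
  "defining_function \<Omega> r \<longleftrightarrow>
     (\<forall>x\<in>\<Omega>. r x < 0) \<and> (\<forall>x\<in>frontier \<Omega>. r x = 0 \<and> grad r x \<noteq> 0)"

text \<open>Second fundamental form of the hypersurface frontier Omega = {r = 0}
  with respect to the inward unit normal nu = - grad r / |grad r|:
  II(X,Y) = <D_X Y, nu> = D^2 r(X,Y) / |grad r|  for X, Y tangent at x.\<close>
definition second_fundamental_form ::
  "(real ^ 'n::finite \<Rightarrow> real) \<Rightarrow> real ^ 'n \<Rightarrow> real ^ 'n \<Rightarrow> real ^ 'n \<Rightarrow> real" where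
  "second_fundamental_form r x X Y = (X \<bullet> (hessian r x *v Y)) / norm (grad r x)"

definition tangent_space :: "(real ^ 'n::finite \<Rightarrow> real) \<Rightarrow> real ^ 'n \<Rightarrow> (real ^ 'n) set" where
  "tangent_space r x = {v. v \<bullet> grad r x = 0}"

text \<open>Trace of II on a subspace W: sum of II(e,e) over an orthonormal basis B of W
  (independent of the choice of B).\<close>
definition orthonormal_basis :: "(real ^ 'n::finite) set \<Rightarrow> (real ^ 'n) set \<Rightarrow> bool" where
  "orthonormal_basis W B \<longleftrightarrow> finite B \<and> B \<subseteq> W \<and> span B = W \<and>
     (\<forall>e\<in>B. norm e = 1) \<and> pairwise orthogonal B"

definition p_convex_boundary :: "nat \<Rightarrow> (real ^ 'n::finite) set \<Rightarrow> (real ^ 'n \<Rightarrow> real) \<Rightarrow> bool" where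
  "p_convex_boundary p \<Omega> r \<longleftrightarrow>
     (\<forall>x\<in>frontier \<Omega>. \<forall>W B. subspace W \<and> dim W = p \<and> W \<subseteq> tangent_space r x \<and>
        orthonormal_basis W B \<longrightarrow> (\<Sum>e\<in>B. second_fundamental_form r x e e) \<ge> 0)"

end

theory Submission
  imports Defs
begin

text \<open>Write \<open>\<rho> = - exp (\<eta> g)\<close> with \<open>g = ln (- r) - K \<phi>\<close>. Up to a positive factor, the trace of the
  Hessian of \<open>\<rho>\<close> on the span of an orthonormal set \<open>B\<close> is
  \<open>K tr(D\<^sup>2\<phi>) + tr(D\<^sup>2r) / \<bar>r\<bar> + \<bar>(grad r)\<^sub>B\<bar>\<^sup>2 / r\<^sup>2 - \<eta> \<bar>(grad g)\<^sub>B\<bar>\<^sup>2\<close>. The decisive estimate is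
  \<open>tr(D\<^sup>2r) \<ge> - C (\<bar>r\<bar> + \<bar>(grad r)\<^sub>B\<bar>)\<close>: at a boundary point at distance \<open>O(\<bar>r\<bar>)\<close> the set \<open>B\<close> is
  tangential up to \<open>O(\<bar>r\<bar> + \<bar>(grad r)\<^sub>B\<bar>)\<close>, and there convexity applies. The quadratic gradient term
  then absorbs \<open>C \<bar>(grad r)\<^sub>B\<bar> / \<bar>r\<bar>\<close>, what remains is bounded below, and a large \<open>K\<close>
  followed by a small \<open>\<eta>\<close> makes the sum positive. Eigenvalue sums and traces on
  orthonormal sets are related by Ky Fan's minimum principle.\<close>

section \<open>Eigenvalue sums and traces on orthonormal sets\<close>

text \<open>Sums of \<open>p\<close> eigenvalues are not linear in the matrix, but the trace on a
  fixed orthonormal set is: with \<open>B\<close> fixed, Hessians at different points and the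
  separate terms of the Hessian of \<open>\<rho>\<close> can be compared one at a time. The obstacle
  is that the trace of the Hessian of \<open>r\<close>, once divided by \<open>|r|\<close>, may tend
  to minus infinity at the boundary, while convexity controls tangential sets only. An error
  proportional to \<open>|r|\<close> becomes a constant after the division, and an error linear in
  the normal part becomes linear in the quotient of that part by \<open>|r|\<close>, which a square
  beats. The square comes from differentiating \<open>1 / r\<close> in the gradient of
  \<open>g\<close>; the exponential takes back only a fraction of it, governed by
  \<open>\<eta>\<close>. The constants of the two Hessian estimates involve neither \<open>K\<close>
  nor \<open>\<eta>\<close>, so \<open>K\<close> can be fixed from them; \<open>\<eta>\<close> comes
  last because the gradient of \<open>g\<close> contains \<open>K\<close>. The comparison point on
  the boundary is reached along one fixed direction near each boundary point, so neither nearest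
  points nor the regularity of the distance function enter.\<close>

definition orthonormal_frame :: "nat \<Rightarrow> 'a::euclidean_space set \<Rightarrow> bool" where
  "orthonormal_frame k B \<longleftrightarrow>
     finite B \<and> card B = k \<and> (\<forall>e\<in>B. norm e = 1) \<and> pairwise orthogonal B"

lemma orthonormal_frameD:
  assumes "orthonormal_frame k B"
  shows "finite B" "card B = k" "\<And>e. e \<in> B \<Longrightarrow> norm e = 1"
    "\<And>e. e \<in> B \<Longrightarrow> e \<bullet> e = 1"
    "\<And>e d. e \<in> B \<Longrightarrow> d \<in> B \<Longrightarrow> e \<noteq> d \<Longrightarrow> e \<bullet> d = 0"
  using assms by (auto simp: orthonormal_frame_def pairwise_def orthogonal_def norm_eq_1)

lemma orthonormal_frame_independent: "orthonormal_frame k B \<Longrightarrow> independent B"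
  by (rule pairwise_orthogonal_independent) (auto simp: orthonormal_frame_def)

lemma orthonormal_frame_subset:
  "orthonormal_frame k B \<Longrightarrow> I \<subseteq> B \<Longrightarrow> orthonormal_frame (card I) I"
  by (auto simp: orthonormal_frame_def intro: finite_subset pairwise_mono)

lemma orthonormal_expansion:
  fixes T :: "'a::euclidean_space set"
  assumes T: "orthonormal_frame k T" and x: "x \<in> span T"
  shows "x = (\<Sum>b\<in>T. (x \<bullet> b) *\<^sub>R b)"
proof -
  note F = orthonormal_frameD[OF T]
  let ?y = "x - (\<Sum>b\<in>T. (x \<bullet> b) *\<^sub>R b)"
  have orth: "?y \<bullet> c = 0" if "c \<in> T" for c
  proof -
    have "(\<Sum>b\<in>T. (x \<bullet> b) * (b \<bullet> c)) = (\<Sum>b\<in>T. if b = c then x \<bullet> c else 0)"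
      using F that by (intro sum.cong) auto
    then show ?thesis
      using F that by (simp add: inner_diff_left inner_sum_left)
  qed
  have "?y \<in> span T"
    using x by (intro span_diff span_sum span_scale) (auto intro: span_base)
  then have "orthogonal ?y ?y"
    using orth by (intro orthogonal_to_span[of ?y T ?y]) (auto simp: orthogonal_def)
  then show ?thesis by (simp add: orthogonal_def)
qed

lemma orthonormal_bessel:
  fixes B :: "'a::euclidean_space set"
  assumes B: "orthonormal_frame k B"
  shows "(\<Sum>e\<in>B. (e \<bullet> x)\<^sup>2) \<le> (norm x)\<^sup>2"
proof -
  note F = orthonormal_frameD[OF B]
  let ?s = "\<Sum>e\<in>B. (e \<bullet> x) *\<^sub>R e"
  have sx: "?s \<bullet> x = (\<Sum>e\<in>B. (e \<bullet> x)\<^sup>2)"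
    by (simp add: inner_sum_left power2_eq_square)
  have "?s \<bullet> d = d \<bullet> x" if "d \<in> B" for d
  proof -
    have "(\<Sum>e\<in>B. (e \<bullet> x) * (e \<bullet> d)) = (\<Sum>e\<in>B. if e = d then d \<bullet> x else 0)"
      using F that by (intro sum.cong) auto
    then show ?thesis using F that by (simp add: inner_sum_left)
  qed
  then have "?s \<bullet> ?s = (\<Sum>e\<in>B. (e \<bullet> x)\<^sup>2)"
    by (subst inner_sum_right) (simp add: power2_eq_square)
  moreover have "0 \<le> (x - ?s) \<bullet> (x - ?s)" by simp
  ultimately show ?thesis
    using sx by (simp add: inner_diff_left inner_diff_right power2_norm_eq_inner inner_commute)
qed

section \<open>Spectral theorem for self-adjoint maps\<close>

lemma quadratic_nonneg_linear_zero:
  fixes a b :: real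
  assumes "\<And>t. 0 \<le> 2 * t * a + t\<^sup>2 * b" shows "a = 0"
proof (rule ccontr)
  assume "a \<noteq> 0"
  \<comment> \<open>Testing at \<open>t = - a / c\<close> gives
    \<open>a\<^sup>2 * (b - 2 * c) / c\<^sup>2\<close>, which is negative as soon as
    \<open>0 < c\<close> and \<open>b < c\<close>.\<close>
  define c where "c = \<bar>b\<bar> + 1"
  have c: "c > 0" "b < c" by (auto simp: c_def)
  have "0 \<le> 2 * (- a / c) * a + (- a / c)\<^sup>2 * b" by (rule assms)
  also have "\<dots> = a\<^sup>2 * (b - 2 * c) / c\<^sup>2"
    using c by (simp add: field_simps power2_eq_square)
  also have "\<dots> < 0"
    using c \<open>a \<noteq> 0\<close> by (intro divide_neg_pos mult_pos_neg) auto
  finally show False by simp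
qed

text \<open>An eigenvector is a maximiser of the quadratic form on the unit sphere of \<open>S\<close>.\<close>
lemma self_adjoint_eigenvector:
  fixes f :: "'a::euclidean_space \<Rightarrow> 'a"
  assumes f: "linear f" and sa: "\<And>x y. f x \<bullet> y = x \<bullet> f y"
    and S: "subspace S" "f ` S \<subseteq> S" "S \<noteq> {0}"
  obtains v m where "v \<in> S" "norm v = 1" "f v = m *\<^sub>R v"
proof -
  let ?C = "sphere 0 1 \<inter> S"
  obtain s where s: "s \<in> S" "s \<noteq> 0"
    using S(1,3) subspace_0 by blast
  then have "s /\<^sub>R norm s \<in> ?C"
    using S(1) by (auto intro: subspace_scale)
  moreover have "compact ?C"
    using S(1) by (intro compact_Int_closed closed_subspace) auto
  moreover have "continuous_on ?C (\<lambda>x. x \<bullet> f x)"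
    using f by (intro continuous_intros linear_continuous_on) (simp add: linear_conv_bounded_linear)
  ultimately obtain v where v: "v \<in> ?C" "\<And>x. x \<in> ?C \<Longrightarrow> x \<bullet> f x \<le> v \<bullet> f v"
    using continuous_attains_sup[of ?C "\<lambda>x. x \<bullet> f x"] by blast
  define m where "m = v \<bullet> f v"
  have vv: "v \<in> S" "norm v = 1" "v \<bullet> v = 1" using v by (auto simp: norm_eq_1)
  have q: "x \<bullet> f x \<le> m * (x \<bullet> x)" if x: "x \<in> S" for x
  proof (cases "x = 0")
    case False
    have "x /\<^sub>R norm x \<in> ?C" using x False S(1) by (auto intro: subspace_scale)
    from v(2)[OF this] have "(x \<bullet> f x) / (norm x)\<^sup>2 \<le> m"
      using f by (simp add: linear_cmul m_def power2_eq_square divide_inverse ac_simps)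
    then show ?thesis using False by (simp add: field_simps power2_norm_eq_inner)
  qed (use f in \<open>simp add: linear_0\<close>)
  \<comment> \<open>Half the gradient at \<open>v\<close> of the form
    \<open>m * (x \<bullet> x) - x \<bullet> f x\<close>, which is nonnegative on \<open>S\<close>
    and vanishes at \<open>v\<close>. Moving in the direction \<open>w\<close> itself makes the
    linear coefficient equal to \<open>w \<bullet> w\<close>.\<close>
  define w where "w = m *\<^sub>R v - f v"
  have w: "w \<in> S"
    unfolding w_def using S vv by (intro subspace_diff subspace_scale) auto
  have "w \<bullet> w = 0"
  proof (rule quadratic_nonneg_linear_zero)
    fix t :: real
    have "v + t *\<^sub>R w \<in> S" using w vv S(1) by (intro subspace_add subspace_scale)
    from q[OF this]
    have "0 \<le> m * (1 + 2 * t * (v \<bullet> w) + t\<^sup>2 * (w \<bullet> w))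
        - (m + t * (v \<bullet> f w) + t * (w \<bullet> f v) + t\<^sup>2 * (w \<bullet> f w))"
      using f vv by (simp add: linear_add linear_cmul inner_add_left inner_add_right
          m_def[symmetric] inner_commute power2_eq_square algebra_simps)
    also have "v \<bullet> f w = w \<bullet> f v" using sa[of v w] by (simp add: inner_commute)
    also have "m * (1 + 2 * t * (v \<bullet> w) + t\<^sup>2 * (w \<bullet> w))
        - (m + t * (w \<bullet> f v) + t * (w \<bullet> f v) + t\<^sup>2 * (w \<bullet> f w))
      = 2 * t * (m * (w \<bullet> v) - w \<bullet> f v) + t\<^sup>2 * (m * (w \<bullet> w) - w \<bullet> f w)"
      by (simp add: algebra_simps inner_commute)
    also have "m * (w \<bullet> v) - w \<bullet> f v = w \<bullet> w"
      by (simp add: w_def inner_diff_right)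
    finally show "0 \<le> 2 * t * (w \<bullet> w) + t\<^sup>2 * (m * (w \<bullet> w) - w \<bullet> f w)" .
  qed
  then have "f v = m *\<^sub>R v" by (simp add: w_def)
  with vv that show thesis by blast
qed

text \<open>An eigenvector splits off an invariant orthogonal complement, and induction on the
  dimension finishes. Working in an invariant subspace serves this induction and is also what the
  hyperplane orthogonal to a normal vector requires later.\<close>

lemma self_adjoint_eigenbasis:
  fixes f :: "'a::euclidean_space \<Rightarrow> 'a"
  assumes f: "linear f" and sa: "\<And>x y. f x \<bullet> y = x \<bullet> f y"
    and S: "subspace S" "f ` S \<subseteq> S"
  shows "\<exists>T. orthonormal_frame (dim S) T \<and> span T = S \<and> (\<forall>b\<in>T. \<exists>m. f b = m *\<^sub>R b)"
  using S
proof (induction "dim S" arbitrary: S)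
  case 0
  then have "S = {0}" using subspace_0 by auto
  then show ?case
    by (intro exI[of _ "{}"]) (auto simp: orthonormal_frame_def)
next
  case (Suc n)
  then have "S \<noteq> {0}" by auto
  with self_adjoint_eigenvector[OF f sa] Suc.prems
  obtain v m where v: "v \<in> S" "norm v = 1" "f v = m *\<^sub>R v" by metis
  then have vv: "v \<bullet> v = 1" by (simp add: norm_eq_1)
  define S' where "S' = {x \<in> S. x \<bullet> v = 0}"
  have sub: "subspace S'"
    using Suc.prems(1) by (auto simp: S'_def subspace_def inner_add_left)
  have inv: "f ` S' \<subseteq> S'"
    using Suc.prems(2) v(3) by (auto simp: S'_def sa)
  have decomp: "x - (x \<bullet> v) *\<^sub>R v \<in> S'" if "x \<in> S" for x
    using that v(1) vv Suc.prems(1)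
    by (auto simp: S'_def inner_diff_left intro!: subspace_diff subspace_scale)
  have "S = span (insert v S')"
  proof
    show "S \<subseteq> span (insert v S')"
    proof
      fix x assume "x \<in> S"
      then have "(x - (x \<bullet> v) *\<^sub>R v) + (x \<bullet> v) *\<^sub>R v \<in> span (insert v S')"
        using decomp by (intro span_add span_scale) (auto intro: span_base)
      then show "x \<in> span (insert v S')" by simp
    qed
    show "span (insert v S') \<subseteq> S"
      using v(1) Suc.prems(1) by (intro span_minimal) (auto simp: S'_def)
  qed
  then have "dim S = dim (insert v S')" by (metis dim_span)
  moreover have "v \<notin> span S'"
    using sub vv by (auto simp: span_eq_iff[THEN iffD2] S'_def)
  ultimately have dS: "dim S = Suc (dim S')" by (simp add: dim_insert)
  then have "n = dim S'" using Suc.hyps(2) by simp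
  from Suc.hyps(1)[OF this sub inv] obtain T where
    T: "orthonormal_frame (dim S') T" "span T = S'" "\<forall>b\<in>T. \<exists>m. f b = m *\<^sub>R b"
    by blast
  have TS: "T \<subseteq> S'" using T(2) span_superset by blast
  have "v \<notin> T" using TS vv by (auto simp: S'_def)
  then have "orthonormal_frame (dim S) (insert v T)"
    using T(1) TS v(2) dS
    by (auto simp: orthonormal_frame_def pairwise_insert orthogonal_def S'_def inner_commute)
  moreover have "span (insert v T) = S"
  proof
    show "span (insert v T) \<subseteq> S"
      using v(1) TS Suc.prems(1) by (intro span_minimal) (auto simp: S'_def)
    show "S \<subseteq> span (insert v T)"
    proof
      fix x assume "x \<in> S"
      then have "(x - (x \<bullet> v) *\<^sub>R v) \<in> span T" using decomp T(2) by simp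
      then have "(x - (x \<bullet> v) *\<^sub>R v) + (x \<bullet> v) *\<^sub>R v \<in> span (insert v T)"
        using span_mono[of T "insert v T"]
        by (intro span_add span_scale) (auto intro: span_base)
      then show "x \<in> span (insert v T)" by simp
    qed
  qed
  moreover have "\<forall>b\<in>insert v T. \<exists>m. f b = m *\<^sub>R b" using T(3) v(3) by auto
  ultimately show ?case by blast
qed

section \<open>Ky Fan's minimum principle\<close>

text \<open>A linear functional on the polytope of weights in \<open>[0, 1]\<close> with total
  \<open>k\<close> attains its minimum at a vertex, that is, at the indicator of a
  \<open>k\<close>-subset. The proof compares with the best \<open>k\<close>-subset directly,
  without extreme points.\<close>

lemma weighted_sum_ge_min_subset_sum:
  fixes l t :: "'i \<Rightarrow> real"
  assumes fin: "finite T" and t: "\<And>i. i \<in> T \<Longrightarrow> 0 \<le> t i \<and> t i \<le> 1"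
    and sum: "(\<Sum>i\<in>T. t i) = real k"
    and sub: "\<And>I. I \<subseteq> T \<Longrightarrow> card I = k \<Longrightarrow> m \<le> (\<Sum>i\<in>I. l i)"
  shows "m \<le> (\<Sum>i\<in>T. l i * t i)"
proof -
  have "real k \<le> (\<Sum>i\<in>T. 1)" unfolding sum[symmetric] using t by (intro sum_mono) auto
  then have "k \<le> card T" by simp
  then obtain J where J: "J \<subseteq> T" "card J = k" using obtain_subset_with_card_n by metis
  let ?P = "{I. I \<subseteq> T \<and> card I = k}"
  have "finite ?P" using fin by simp
  moreover have "?P \<noteq> {}" using J by blast
  ultimately obtain I where I: "I \<subseteq> T" "card I = k"
    and min: "\<And>J. J \<subseteq> T \<Longrightarrow> card J = k \<Longrightarrow> sum l I \<le> sum l J"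
    using finite_has_minimal2[of "sum l ` ?P"] ex_min_if_finite[of "sum l ` ?P"]
    by (auto simp: not_less)
  have finI: "finite I" using I fin finite_subset by auto
  have exch: "l i \<le> l j" if "i \<in> I" "j \<in> T - I" for i j
  proof -
    have "card (insert j (I - {i})) = k"
      using that finI I(2) card_Suc_Diff1[of I i] by simp
    then have "sum l I \<le> sum l (insert j (I - {i}))" using I that by (intro min) auto
    also have "\<dots> = l j + (sum l I - l i)"
      using that finI by (simp add: sum_diff1)
    finally show ?thesis by simp
  qed
  \<comment> \<open>A threshold separating the values on \<open>I\<close> from those off
    \<open>I\<close>. Once it is subtracted from \<open>l\<close>, weights below 1 on
    \<open>I\<close> and above 0 off \<open>I\<close> can only raise the sum, and both sides shift
    equally because the weights add up to \<open>k\<close>.\<close>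
  have "\<exists>c. (\<forall>i\<in>I. l i \<le> c) \<and> (\<forall>j\<in>T - I. c \<le> l j)"
  proof (cases "I = {}")
    \<comment> \<open>Any lower bound of \<open>l\<close> on \<open>T\<close> serves;
      \<open>0\<close> is inserted so that \<open>Min\<close> ranges over a nonempty set even if
      \<open>T\<close> is empty.\<close>
    case True
    then show ?thesis
      using fin by (intro exI[of _ "Min (insert 0 (l ` T))"]) auto
  next
    case False
    then show ?thesis
      using finI exch by (intro exI[of _ "Max (l ` I)"]) (auto simp: Max_le_iff)
  qed
  then obtain c where c: "\<And>i. i \<in> I \<Longrightarrow> l i \<le> c" "\<And>j. j \<in> T - I \<Longrightarrow> c \<le> l j" by blast
  have "(\<Sum>i\<in>T. (l i - c) * t i) \<ge> (\<Sum>i\<in>I. l i - c)"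
  proof -
    have "(\<Sum>i\<in>I. l i - c) \<le> (\<Sum>i\<in>I. (l i - c) * t i)"
    proof (intro sum_mono)
      fix i assume "i \<in> I"
      then have "(l i - c) * 1 \<le> (l i - c) * t i"
        using c(1) t I by (intro mult_left_mono_neg) auto
      then show "l i - c \<le> (l i - c) * t i" by simp
    qed
    also have "\<dots> \<le> (\<Sum>i\<in>T. (l i - c) * t i)"
      using fin I c(2) t by (intro sum_mono2) auto
    finally show ?thesis .
  qed
  then have "sum l I - c * k \<le> (\<Sum>i\<in>T. l i * t i) - c * (\<Sum>i\<in>T. t i)"
    using I by (simp add: sum_subtractf left_diff_distrib sum_distrib_left mult.commute[of c "real k"])
  then show ?thesis using sum sub[OF I] by simp
qed

text \<open>Expanding each \<open>e\<close> in the eigenbasis turns the trace into a weighted sum of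
  eigenvalues, the weight of \<open>b\<close> being the squared length of its projection to the span
  of \<open>B\<close>. Bessel bounds the weights by 1, and their total is \<open>p\<close> since
  each \<open>e\<close> is a unit vector.\<close>

lemma orthonormal_frame_trace_ge:
  fixes f :: "'a::euclidean_space \<Rightarrow> 'a"
  assumes f: "linear f"
    and T: "orthonormal_frame k T" "span T = UNIV" "\<And>b. b \<in> T \<Longrightarrow> f b = l b *\<^sub>R b"
    and sub: "\<And>I. I \<subseteq> T \<Longrightarrow> card I = p \<Longrightarrow> m \<le> (\<Sum>b\<in>I. l b)"
    and B: "orthonormal_frame p B"
  shows "m \<le> (\<Sum>e\<in>B. e \<bullet> f e)"
proof -
  note FT = orthonormal_frameD[OF T(1)] and FB = orthonormal_frameD[OF B]
  have exp: "x = (\<Sum>b\<in>T. (x \<bullet> b) *\<^sub>R b)" for x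
    using orthonormal_expansion[OF T(1), of x] T(2) by simp
  have quad: "e \<bullet> f e = (\<Sum>b\<in>T. l b * (e \<bullet> b)\<^sup>2)" for e
  proof -
    have "f e = (\<Sum>b\<in>T. (e \<bullet> b) *\<^sub>R f b)"
      using arg_cong[OF exp[of e], of f] f by (simp add: linear_sum linear_cmul)
    then show ?thesis
      using T(3) by (simp add: inner_sum_right power2_eq_square ac_simps)
  qed
  have one: "(\<Sum>b\<in>T. (e \<bullet> b)\<^sup>2) = e \<bullet> e" for e
    using arg_cong[OF exp[of e], of "\<lambda>y. e \<bullet> y"]
    by (simp add: inner_sum_right power2_eq_square)
  have "m \<le> (\<Sum>b\<in>T. l b * (\<Sum>e\<in>B. (e \<bullet> b)\<^sup>2))"
  proof (rule weighted_sum_ge_min_subset_sum[where k = p])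
    show "finite T" by (rule FT)
    show "0 \<le> (\<Sum>e\<in>B. (e \<bullet> b)\<^sup>2) \<and> (\<Sum>e\<in>B. (e \<bullet> b)\<^sup>2) \<le> 1" if "b \<in> T" for b
      using orthonormal_bessel[OF B, of b] FT(3)[OF that] by (simp add: sum_nonneg)
    have "(\<Sum>b\<in>T. \<Sum>e\<in>B. (e \<bullet> b)\<^sup>2) = (\<Sum>e\<in>B. \<Sum>b\<in>T. (e \<bullet> b)\<^sup>2)"
      by (rule sum.swap)
    also have "\<dots> = real p" using FB by (simp add: one)
    finally show "(\<Sum>b\<in>T. \<Sum>e\<in>B. (e \<bullet> b)\<^sup>2) = real p" .
  qed (use sub in auto)
  also have "\<dots> = (\<Sum>e\<in>B. e \<bullet> f e)"
    unfolding quad sum_distrib_left by (rule sum.swap)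
  finally show ?thesis .
qed

lemma symmetric_matrix_inner:
  fixes A :: "real ^ 'n ^ 'n"
  assumes "transpose A = A" shows "(A *v x) \<bullet> y = x \<bullet> (A *v y)"
  by (metis assms dot_lmul_matrix inner_commute vector_transpose_matrix)

text \<open>Indexing the eigenbasis by \<open>'n\<close> lets it form the columns of a matrix and
  keeps equal eigenvalues apart.\<close>

lemma symmetric_matrix_eigenbasis:
  fixes A :: "real ^ 'n ^ 'n"
  assumes "transpose A = A"
  obtains b :: "'n \<Rightarrow> real ^ 'n" and l where "inj b" "orthonormal_frame CARD('n) (range b)"
    "span (range b) = UNIV" "\<And>i. A *v b i = l i *\<^sub>R b i"
proof -
  have "\<exists>T. orthonormal_frame (dim (UNIV :: (real^'n) set)) T \<and> span T = (UNIV :: (real^'n) set)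
      \<and> (\<forall>b\<in>T. \<exists>m. A *v b = m *\<^sub>R b)"
    using symmetric_matrix_inner[OF assms]
    by (intro self_adjoint_eigenbasis) auto
  then obtain T where T: "orthonormal_frame CARD('n) T" "span T = (UNIV :: (real^'n) set)"
    "\<forall>b\<in>T. \<exists>m. A *v b = m *\<^sub>R b" by auto
  have "finite T" "card T = card (UNIV :: 'n set)" using orthonormal_frameD[OF T(1)] by auto
  then obtain b where b: "bij_betw b (UNIV :: 'n set) T"
    using finite_same_card_bij[of "UNIV :: 'n set" T] by auto
  then have "range b = T" "inj b" by (auto simp: bij_betw_def)
  moreover have "\<exists>l. \<forall>i. A *v b i = l i *\<^sub>R b i"
    using T(3) \<open>range b = T\<close> by (intro choice) auto
  ultimately show thesis using T that by blast
qed

section \<open>Characteristic polynomial and eigenvalue multisets\<close>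

lemma poly_char_poly:
  fixes A :: "real ^ 'n ^ 'n"
  shows "poly (char_poly A) t = det (t *\<^sub>R mat 1 - A)"
proof -
  have *: "(t *\<^sub>R mat 1 - A) $ i $ j
      = poly ((if i = j then [:0, 1:] else 0) - [:A $ i $ j:]) t" for i j
    by (simp add: mat_def)
  show ?thesis
    unfolding char_poly_def det_def * by (simp add: poly_sum poly_prod)
qed

text \<open>Diagonalising \<open>A\<close> by the orthogonal matrix \<open>Q\<close> with columns
  \<open>b j\<close> splits the characteristic polynomial into linear factors. Algebraic
  multiplicity in \<open>eigenvalues\<close> thus becomes counting indices of the
  eigenbasis.\<close>

lemma eigenvalues_eigenbasis:
  fixes A :: "real ^ 'n ^ 'n" and b :: "'n \<Rightarrow> real ^ 'n"
  assumes b: "inj b" "orthonormal_frame CARD('n) (range b)" "\<And>i. A *v b i = l i *\<^sub>R b i"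
  shows "eigenvalues A = image_mset l (mset_set UNIV)"
proof -
  note F = orthonormal_frameD[OF b(2)]
  define Q :: "real ^ 'n ^ 'n" where "Q = (\<chi> i j. b j $ i)"
  define D :: "real ^ 'n ^ 'n" where "D = (\<chi> i j. if i = j then l i else 0)"
  have col: "column j Q = b j" for j by (simp add: Q_def column_def)
  have Q: "orthogonal_matrix Q"
    unfolding orthogonal_matrix_orthonormal_columns col
    using F(3)[OF rangeI] F(5)[OF rangeI rangeI] b(1)
    by (auto simp: orthogonal_def dest: injD)
  have AQ: "A ** Q = Q ** D"
  proof -
    have "(A ** Q) $ i $ j = (A *v b j) $ i" for i j
      by (simp add: matrix_matrix_mult_def matrix_vector_mult_def Q_def)
    moreover have "(Q ** D) $ i $ j = l j * b j $ i" for i j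
      by (simp add: matrix_matrix_mult_def Q_def D_def if_distrib sum.delta' cong: if_cong)
    ultimately show ?thesis using b(3) by (simp add: vec_eq_iff)
  qed
  have det: "det (t *\<^sub>R mat 1 - A) = (\<Prod>i\<in>UNIV. t - l i)" for t
  proof -
    have "(t *\<^sub>R mat 1 - A) ** Q = Q ** (t *\<^sub>R mat 1 - D)"
    proof (subst matrix_eq, intro allI)
      fix x
      have "A *v (Q *v x) = Q *v (D *v x)"
        using AQ by (simp add: matrix_vector_mul_assoc)
      then show "((t *\<^sub>R mat 1 - A) ** Q) *v x = (Q ** (t *\<^sub>R mat 1 - D)) *v x"
        by (simp add: matrix_vector_mult_diff_rdistrib matrix_vector_mult_diff_distrib
            matrix_vector_mult_scaleR
            flip: matrix_vector_mul_assoc scaleR_matrix_vector_assoc)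
    qed
    then have "det (t *\<^sub>R mat 1 - A) * det Q = det Q * det (t *\<^sub>R mat 1 - D)"
      by (metis det_mul)
    moreover have "det Q \<noteq> 0" using det_orthogonal_matrix[OF Q] by auto
    ultimately have "det (t *\<^sub>R mat 1 - A) = det (t *\<^sub>R mat 1 - D)" by simp
    also have "\<dots> = (\<Prod>i\<in>UNIV. t - l i)"
      by (subst det_diagonal) (auto simp: D_def mat_def)
    finally show ?thesis .
  qed
  have "char_poly A = (\<Prod>i\<in>UNIV. [:- l i, 1:])"
    by (rule poly_eq_poly_eq_iff[THEN iffD1], rule ext)
       (simp add: poly_char_poly det poly_prod)
  then show ?thesis
    by (simp add: eigenvalues_def proots_prod sum_unfold_sum_mset)
qed

text \<open>Lets a choice of \<open>p\<close> eigenvalues with multiplicity be read as a choice of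
  \<open>p\<close> indices. In the induction the new index \<open>a\<close> takes one copy of
  \<open>f a\<close> whenever \<open>M\<close> contains one.\<close>

lemma subset_image_mset_set:
  assumes "finite A" "M \<subseteq># image_mset f (mset_set A)"
  shows "\<exists>I\<subseteq>A. M = image_mset f (mset_set I)"
  using assms
proof (induction A arbitrary: M rule: finite_induct)
  case empty
  then show ?case by simp
next
  case (insert a A)
  have sub: "M \<subseteq># add_mset (f a) (image_mset f (mset_set A))" using insert by simp
  show ?case
  proof (cases "f a \<in># M")
    case True
    then have M: "M = add_mset (f a) (M - {#f a#})" by simp
    then have "M - {#f a#} \<subseteq># image_mset f (mset_set A)"
      using sub by (metis mset_subset_eq_add_mset_cancel)
    then obtain I where I: "I \<subseteq> A" "M - {#f a#} = image_mset f (mset_set I)"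
      using insert.IH by blast
    have "a \<notin> I" "finite I" using I insert finite_subset by auto
    then have "M = image_mset f (mset_set (insert a I))" using I(2) M by simp
    then show ?thesis using I by blast
  next
    case False
    have "M \<subseteq># image_mset f (mset_set A)"
    proof (intro mset_subset_eqI)
      fix x
      have "count M x \<le> count (add_mset (f a) (image_mset f (mset_set A))) x"
        using sub by (rule mset_subset_eq_count)
      then show "count M x \<le> count (image_mset f (mset_set A)) x"
        using False by (cases "x = f a") (simp_all add: not_in_iff)
    qed
    then show ?thesis using insert.IH by blast
  qed
qed

lemma p_pos_def_iff_subset_sums:
  fixes A :: "real ^ 'n ^ 'n" and b :: "'n \<Rightarrow> real ^ 'n"
  assumes A: "transpose A = A"
    and b: "inj b" "orthonormal_frame CARD('n) (range b)" "\<And>i. A *v b i = l i *\<^sub>R b i"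
  shows "p_pos_def p A \<longleftrightarrow> (\<forall>I. card I = p \<longrightarrow> 0 < (\<Sum>i\<in>I. l i))"
proof -
  have E: "eigenvalues A = image_mset l (mset_set UNIV)"
    using b by (rule eigenvalues_eigenbasis)
  show ?thesis
  proof
    assume P: "p_pos_def p A"
    show "\<forall>I. card I = p \<longrightarrow> 0 < (\<Sum>i\<in>I. l i)"
    proof (intro allI impI)
      fix I :: "'n set" assume "card I = p"
      moreover have "image_mset l (mset_set I) \<subseteq># eigenvalues A"
        unfolding E by (intro image_mset_subseteq_mono) simp
      ultimately show "0 < (\<Sum>i\<in>I. l i)"
        using P by (auto simp: p_pos_def_def sum_unfold_sum_mset)
    qed
  next
    assume P: "\<forall>I. card I = p \<longrightarrow> 0 < (\<Sum>i\<in>I. l i)"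
    show "p_pos_def p A"
      unfolding p_pos_def_def E
    proof (intro conjI A allI impI, elim conjE)
      fix M assume M: "M \<subseteq># image_mset l (mset_set UNIV)" "size M = p"
      then obtain I where "M = image_mset l (mset_set I)"
        using subset_image_mset_set[of UNIV M l] by auto
      then show "0 < \<Sum>\<^sub># M" using P M by (auto simp: sum_unfold_sum_mset)
    qed
  qed
qed

text \<open>Ky Fan applied to the least sum of \<open>p\<close> eigenvalues. There are finitely many
  such sums, so one bound \<open>m\<close> serves all frames; this margin is what survives a small
  change of the matrix.\<close>

lemma p_pos_def_frame_trace:
  fixes A :: "real ^ 'n ^ 'n"
  assumes P: "p_pos_def p A"
  obtains m where "0 < m" "\<And>B. orthonormal_frame p B \<Longrightarrow> m \<le> (\<Sum>e\<in>B. e \<bullet> (A *v e))"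
proof -
  have A: "transpose A = A" using P by (simp add: p_pos_def_def)
  obtain b :: "'n \<Rightarrow> real ^ 'n" and l where b: "inj b" "orthonormal_frame CARD('n) (range b)"
    "span (range b) = UNIV" "\<And>i. A *v b i = l i *\<^sub>R b i"
    using symmetric_matrix_eigenbasis[OF A] by blast
  have pos: "0 < (\<Sum>i\<in>I. l i)" if "card I = p" for I
    using p_pos_def_iff_subset_sums[OF A b(1,2,4)] P that by blast
  \<comment> \<open>The \<open>1\<close> keeps the set nonempty if there is no index set of size
    \<open>p\<close>.\<close>
  define m where "m = Min (insert 1 (sum l ` {I. card I = p}))"
  have "0 < m" unfolding m_def using pos by (subst Min_gr_iff) auto
  moreover have "m \<le> (\<Sum>e\<in>B. e \<bullet> (A *v e))" if B: "orthonormal_frame p B" for B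
  proof (rule orthonormal_frame_trace_ge[OF _ b(2,3) _ _ B, where l = "l \<circ> inv b"])
    fix I assume I: "I \<subseteq> range b" "card I = p"
    then obtain J where J: "I = b ` J" by (auto simp: subset_image_iff)
    have "inj_on b J" using b(1) inj_on_subset by blast
    then have "card J = p" "(\<Sum>e\<in>I. (l \<circ> inv b) e) = sum l J"
      using I(2) b(1) by (auto simp: J card_image sum.reindex)
    then show "m \<le> (\<Sum>e\<in>I. (l \<circ> inv b) e)"
      unfolding m_def by (auto intro!: Min_le)
  qed (use b in auto)
  ultimately show thesis using that by blast
qed

text \<open>Any \<open>p\<close> vectors of an eigenbasis form an admissible \<open>B\<close>, and
  the trace on them is the sum of their eigenvalues.\<close>

lemma p_pos_defI_frame_trace:
  fixes A :: "real ^ 'n ^ 'n"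
  assumes A: "transpose A = A"
    and pos: "\<And>B. orthonormal_frame p B \<Longrightarrow> 0 < (\<Sum>e\<in>B. e \<bullet> (A *v e))"
  shows "p_pos_def p A"
proof -
  obtain b :: "'n \<Rightarrow> real ^ 'n" and l where b: "inj b" "orthonormal_frame CARD('n) (range b)"
    "span (range b) = UNIV" "\<And>i. A *v b i = l i *\<^sub>R b i"
    using symmetric_matrix_eigenbasis[OF A] by blast
  have "0 < (\<Sum>i\<in>I. l i)" if "card I = p" for I
  proof -
    have inj: "inj_on b I" using b(1) inj_on_subset by blast
    then have "orthonormal_frame p (b ` I)"
      using orthonormal_frame_subset[OF b(2), of "b ` I"] that by (simp add: card_image image_mono)
    then have "0 < (\<Sum>e\<in>b ` I. e \<bullet> (A *v e))" by (rule pos)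
    also have "\<dots> = sum l I"
      using orthonormal_frameD(4)[OF b(2)] by (simp add: sum.reindex[OF inj] b(4))
    finally show ?thesis .
  qed
  then show ?thesis using p_pos_def_iff_subset_sums[OF A b(1,2,4)] by blast
qed

section \<open>Smooth functions\<close>

lemma smooth_on_differentiable:
  "smooth_on U f \<Longrightarrow> x \<in> U \<Longrightarrow> pd is f differentiable (at x)"
  unfolding smooth_on_def differentiable_on_def by (metis at_within_open)

lemma pd_append: "pd (is @ js) f = pd is (pd js f)"
  by (induction "is") auto

lemma smooth_on_pd: "smooth_on U f \<Longrightarrow> smooth_on U (pd is f)"
  unfolding smooth_on_def by (simp flip: pd_append)

lemma smooth_on_continuous_on: "smooth_on U f \<Longrightarrow> S \<subseteq> U \<Longrightarrow> continuous_on S (pd is f)"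
  unfolding smooth_on_def using differentiable_imp_continuous_on continuous_on_subset by blast

lemma pd_eqI: "(f has_derivative f') (at x) \<Longrightarrow> pd [i] f x = f' (axis i 1)"
  by (simp add: frechet_derivative_at[symmetric])

text \<open>Exposes the outer derivative only. Unfolding \<open>pd.simps\<close> would turn the
  inner one into a Frechet derivative as well, hence the removal of those equations from the
  simplifier in the computations below.\<close>

lemma pd_Cons2: "pd [i, j] f = pd [i] (pd [j] f)"
  by simp

lemma has_derivative_grad:
  assumes "f differentiable (at x)"
  shows "(f has_derivative (\<lambda>h. h \<bullet> grad f x)) (at x)"
proof -
  let ?D = "frechet_derivative f (at x)"
  have D: "(f has_derivative ?D) (at x)" using assms by (simp add: frechet_derivative_works)
  then have lin: "linear ?D" by (rule has_derivative_linear)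
  have "?D h = h \<bullet> grad f x" for h
  proof -
    have "?D h = ?D (\<Sum>i\<in>UNIV. h $ i *\<^sub>R axis i 1)"
      using basis_expansion[of h] by (simp add: scalar_mult_eq_scaleR)
    also have "\<dots> = (\<Sum>i\<in>UNIV. h $ i * ?D (axis i 1))"
      using lin by (simp add: linear_sum linear_cmul)
    also have "\<dots> = h \<bullet> grad f x"
      by (simp add: grad_def inner_vec_def)
    finally show ?thesis .
  qed
  then have "?D = (\<lambda>h. h \<bullet> grad f x)" by auto
  with D show ?thesis by simp
qed

lemma smooth_on_has_derivative:
  "smooth_on U f \<Longrightarrow> x \<in> U \<Longrightarrow> (f has_derivative (\<lambda>h. h \<bullet> grad f x)) (at x)"
  using has_derivative_grad smooth_on_differentiable[of U f x "[]"] by simp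

lemma smooth_on_has_field_derivative_line:
  assumes "smooth_on U f" "x + s *\<^sub>R v \<in> U"
  shows "((\<lambda>s. f (x + s *\<^sub>R v)) has_field_derivative (v \<bullet> grad f (x + s *\<^sub>R v))) (at s)"
proof -
  have "((\<lambda>s. f (x + s *\<^sub>R v)) has_derivative (\<lambda>h. (h *\<^sub>R v) \<bullet> grad f (x + s *\<^sub>R v))) (at s)"
    by (rule has_derivative_compose[where g = f and f = "\<lambda>s. x + s *\<^sub>R v", OF _ smooth_on_has_derivative[OF assms]])
       (auto intro!: derivative_eq_intros)
  then show ?thesis
    by (simp add: has_field_derivative_def mult.commute[of _ "v \<bullet> _"] mult_commute_abs)
qed

lemma continuous_on_grad: "smooth_on U f \<Longrightarrow> S \<subseteq> U \<Longrightarrow> continuous_on S (grad f)"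
  unfolding grad_def by (intro continuous_intros) (rule smooth_on_continuous_on)

lemma axis_inner_grad: "axis i 1 \<bullet> grad f x = pd [i] f x"
  by (simp add: grad_def inner_axis')

section \<open>Symmetry of second derivatives\<close>

text \<open>Two applications of the mean value theorem: in direction \<open>i\<close> to the
  increment \<open>g\<close> along \<open>j\<close>, then in direction \<open>j\<close> to
  \<open>pd [i] f\<close>. The bound \<open>2 * t < \<epsilon>\<close> keeps the whole parallelogram
  inside the ball.\<close>

lemma second_difference_mvt:
  fixes f :: "real ^ 'n \<Rightarrow> real"
  assumes f: "smooth_on U f" and U: "ball x \<epsilon> \<subseteq> U" and t: "0 < t" "2 * t < \<epsilon>"
  shows "\<exists>\<xi>\<in>ball x \<epsilon>. f (x + t *\<^sub>R axis i 1 + t *\<^sub>R axis j 1) - f (x + t *\<^sub>R axis i 1)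
      - f (x + t *\<^sub>R axis j 1) + f x = t\<^sup>2 * pd [j, i] f \<xi>"
proof -
  let ?v = "axis i 1 :: real ^ 'n" and ?w = "axis j 1 :: real ^ 'n"
  have ball: "x + a *\<^sub>R ?v + b *\<^sub>R ?w \<in> ball x \<epsilon>" if "0 \<le> a" "a \<le> t" "0 \<le> b" "b \<le> t" for a b
  proof -
    have "norm (a *\<^sub>R ?v + b *\<^sub>R ?w) \<le> norm (a *\<^sub>R ?v) + norm (b *\<^sub>R ?w)"
      by (rule norm_triangle_ineq)
    also have "\<dots> = a + b" using that by (simp add: norm_axis_1)
    also have "\<dots> < \<epsilon>" using that t by simp
    finally have "norm (- (a *\<^sub>R ?v + b *\<^sub>R ?w)) < \<epsilon>" by (simp only: norm_minus_cancel)
    then show ?thesis by (simp add: dist_norm algebra_simps)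
  qed
  define g where "g s = f ((x + t *\<^sub>R ?w) + s *\<^sub>R ?v) - f (x + s *\<^sub>R ?v)" for s
  have "\<exists>z>0. z < t \<and> g t - g 0 = (t - 0) *
      (?v \<bullet> grad f ((x + t *\<^sub>R ?w) + z *\<^sub>R ?v) - ?v \<bullet> grad f (x + z *\<^sub>R ?v))"
  proof (rule MVT2)
    fix s assume s: "0 \<le> s" "s \<le> t"
    show "(g has_real_derivative ?v \<bullet> grad f (x + t *\<^sub>R ?w + s *\<^sub>R ?v) - ?v \<bullet> grad f (x + s *\<^sub>R ?v)) (at s)"
      unfolding g_def using ball[of s t] ball[of s 0] s t U
      by (intro DERIV_diff smooth_on_has_field_derivative_line[OF f]) (auto simp: add_ac)
  qed (rule t)
  then obtain z where z: "0 < z" "z < t"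
    and gz: "g t - g 0 = t * (pd [i] f ((x + z *\<^sub>R ?v) + t *\<^sub>R ?w) - pd [i] f (x + z *\<^sub>R ?v))"
    by (auto simp: axis_inner_grad add_ac simp del: pd.simps)
  define h where "h s = pd [i] f ((x + z *\<^sub>R ?v) + s *\<^sub>R ?w)" for s
  have "\<exists>y>0. y < t \<and> h t - h 0 = (t - 0) * (?w \<bullet> grad (pd [i] f) ((x + z *\<^sub>R ?v) + y *\<^sub>R ?w))"
  proof (rule MVT2)
    fix s assume s: "0 \<le> s" "s \<le> t"
    show "(h has_real_derivative ?w \<bullet> grad (pd [i] f) ((x + z *\<^sub>R ?v) + s *\<^sub>R ?w)) (at s)"
      unfolding h_def using ball[of z s] z s t U
      by (intro smooth_on_has_field_derivative_line[OF smooth_on_pd[OF f]]) auto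
  qed (rule t)
  then obtain y where y: "0 < y" "y < t"
    and hy: "h t - h 0 = t * pd [j, i] f ((x + z *\<^sub>R ?v) + y *\<^sub>R ?w)"
    by (auto simp: axis_inner_grad pd_Cons2 simp del: pd.simps)
  have "g t - g 0 = t * (h t - h 0)" unfolding gz h_def by simp
  then have "g t - g 0 = t\<^sup>2 * pd [j, i] f ((x + z *\<^sub>R ?v) + y *\<^sub>R ?w)"
    unfolding hy by (simp add: power2_eq_square)
  then show ?thesis
    using ball[of z y] y z unfolding g_def
    by (intro bexI[of _ "(x + z *\<^sub>R ?v) + y *\<^sub>R ?w"]) (auto simp: add_ac simp del: pd.simps)
qed

text \<open>The second difference is symmetric in \<open>i\<close> and \<open>j\<close>, so both
  mixed derivatives take a common value within \<open>\<epsilon>\<close> of \<open>x\<close>,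
  possibly at different points. By continuity each is then closer to its value at \<open>x\<close>
  than half the supposed gap, a contradiction.\<close>

lemma pd_commute:
  assumes f: "smooth_on U f" and x: "x \<in> U"
  shows "pd [i, j] f x = pd [j, i] f x"
proof (rule ccontr)
  let ?F = "pd [i, j] f" and ?G = "pd [j, i] f"
  assume "?F x \<noteq> ?G x"
  then have d: "\<bar>?F x - ?G x\<bar> / 2 > 0" (is "?d > 0") by simp
  have U: "open U" using f by (simp add: smooth_on_def)
  have "isCont ?F x" "isCont ?G x"
    using f x by (auto intro!: differentiable_imp_continuous_within smooth_on_differentiable
        simp del: pd.simps)
  then obtain e1 e2 where e: "e1 > 0" "e2 > 0"
    "\<And>y. dist y x < e1 \<Longrightarrow> dist (?F y) (?F x) < ?d"
    "\<And>y. dist y x < e2 \<Longrightarrow> dist (?G y) (?G x) < ?d"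
    using d unfolding continuous_at_eps_delta by (metis dist_commute)
  obtain e3 where e3: "e3 > 0" "ball x e3 \<subseteq> U" using U x openE by blast
  define \<epsilon> where "\<epsilon> = min e1 (min e2 e3)"
  have eps: "\<epsilon> > 0" "ball x \<epsilon> \<subseteq> U" using e e3 by (auto simp: \<epsilon>_def)
  define t where "t = \<epsilon> / 3"
  have t: "0 < t" "2 * t < \<epsilon>" using eps by (auto simp: t_def)
  obtain \<xi> where xi: "\<xi> \<in> ball x \<epsilon>"
    "f (x + t *\<^sub>R axis i 1 + t *\<^sub>R axis j 1) - f (x + t *\<^sub>R axis i 1)
      - f (x + t *\<^sub>R axis j 1) + f x = t\<^sup>2 * ?G \<xi>"
    using second_difference_mvt[OF f eps(2) t] by blast
  obtain \<zeta> where zeta: "\<zeta> \<in> ball x \<epsilon>"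
    "f (x + t *\<^sub>R axis j 1 + t *\<^sub>R axis i 1) - f (x + t *\<^sub>R axis j 1)
      - f (x + t *\<^sub>R axis i 1) + f x = t\<^sup>2 * ?F \<zeta>"
    using second_difference_mvt[OF f eps(2) t] by blast
  have "t\<^sup>2 * ?G \<xi> = t\<^sup>2 * ?F \<zeta>"
    unfolding xi(2)[symmetric] zeta(2)[symmetric] by (simp add: add_ac)
  then have "?G \<xi> = ?F \<zeta>" using t by simp
  moreover have "dist (?F \<zeta>) (?F x) < ?d" "dist (?G \<xi>) (?G x) < ?d"
    using e(3)[of \<zeta>] e(4)[of \<xi>] xi(1) zeta(1)
    by (simp_all add: \<epsilon>_def dist_commute del: pd.simps)
  ultimately show False unfolding dist_real_def by argo
qed

lemma transpose_hessian: "smooth_on U f \<Longrightarrow> x \<in> U \<Longrightarrow> transpose (hessian f x) = hessian f x"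
  by (simp add: transpose_def hessian_def vec_eq_iff pd_commute del: pd.simps)

section \<open>Uniform bounds for derivatives on compact sets\<close>

lemma smooth_on_lipschitz:
  assumes f: "smooth_on U f" and S: "compact S" "convex S" "S \<subseteq> U"
  shows "\<exists>L\<ge>0. \<forall>x\<in>S. \<forall>y\<in>S. \<bar>f x - f y\<bar> \<le> L * norm (x - y)"
proof -
  have "bounded (grad f ` S)"
    using f S by (intro compact_imp_bounded compact_continuous_image continuous_on_grad)
  then obtain L where L: "L > 0" "\<And>x. x \<in> S \<Longrightarrow> norm (grad f x) \<le> L"
    unfolding bounded_pos by auto
  have "norm (f x - f y) \<le> L * norm (x - y)" if "x \<in> S" "y \<in> S" for x y
  proof (rule differentiable_bound[OF S(2)])
    fix z assume z: "z \<in> S"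
    show "(f has_derivative (\<lambda>h. h \<bullet> grad f z)) (at z within S)"
      using smooth_on_has_derivative[OF f] S(3) z by (blast intro: has_derivative_at_withinI)
    show "onorm (\<lambda>h. h \<bullet> grad f z) \<le> L"
    proof (rule onorm_le)
      fix h
      have "norm (h \<bullet> grad f z) \<le> norm h * norm (grad f z)"
        by (simp add: Cauchy_Schwarz_ineq2)
      also have "\<dots> \<le> norm h * L" using L z by (intro mult_left_mono) auto
      finally show "norm (h \<bullet> grad f z) \<le> L * norm h" by (simp add: mult.commute)
    qed
  qed (use that in auto)
  then show ?thesis using L by (intro exI[of _ L]) auto
qed

lemma norm_matrix_vector_le:
  fixes A :: "real ^ 'n ^ 'm"
  shows "norm (A *v x) \<le> (\<Sum>i\<in>UNIV. \<Sum>j\<in>UNIV. \<bar>A $ i $ j\<bar>) * norm x"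
proof -
  have "norm (A *v x) \<le> onorm ((*v) A) * norm x"
    by (intro onorm matrix_vector_mul_bounded_linear)
  also have "\<dots> \<le> (\<Sum>i\<in>UNIV. \<Sum>j\<in>UNIV. \<bar>A $ i $ j\<bar>) * norm x"
    by (intro mult_right_mono onorm_le_matrix_component_sum) auto
  finally show ?thesis .
qed

lemma grad_lipschitz:
  assumes f: "smooth_on U f" and S: "compact S" "convex S" "S \<subseteq> U"
  shows "\<exists>L\<ge>0. \<forall>x\<in>S. \<forall>y\<in>S. norm (grad f x - grad f y) \<le> L * norm (x - y)"
proof -
  have "\<forall>i. \<exists>L\<ge>0. \<forall>x\<in>S. \<forall>y\<in>S. \<bar>pd [i] f x - pd [i] f y\<bar> \<le> L * norm (x - y)"
    using smooth_on_lipschitz[OF smooth_on_pd[OF f] S] by blast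
  then obtain L where L: "\<And>i. L i \<ge> 0"
    "\<And>i x y. x \<in> S \<Longrightarrow> y \<in> S \<Longrightarrow> \<bar>pd [i] f x - pd [i] f y\<bar> \<le> L i * norm (x - y)"
    by metis
  have "norm (grad f x - grad f y) \<le> (\<Sum>i\<in>UNIV. L i) * norm (x - y)" if "x \<in> S" "y \<in> S" for x y
  proof -
    have "norm (grad f x - grad f y) \<le> (\<Sum>i\<in>UNIV. \<bar>(grad f x - grad f y) $ i\<bar>)"
      by (rule norm_le_l1_cart)
    also have "\<dots> \<le> (\<Sum>i\<in>UNIV. L i * norm (x - y))"
      using L(2)[OF that] by (intro sum_mono) (simp add: grad_def del: pd.simps)
    finally show ?thesis by (simp add: sum_distrib_right)
  qed
  then show ?thesis using L(1) by (intro exI[of _ "\<Sum>i\<in>UNIV. L i"]) (auto intro: sum_nonneg)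
qed

lemma hessian_lipschitz:
  assumes f: "smooth_on U f" and S: "compact S" "convex S" "S \<subseteq> U"
  shows "\<exists>L\<ge>0. \<forall>x\<in>S. \<forall>y\<in>S. \<forall>e. norm (hessian f x *v e - hessian f y *v e) \<le> L * norm (x - y) * norm e"
proof -
  have "\<forall>i j. \<exists>L\<ge>0. \<forall>x\<in>S. \<forall>y\<in>S. \<bar>pd [i, j] f x - pd [i, j] f y\<bar> \<le> L * norm (x - y)"
    using smooth_on_lipschitz[OF smooth_on_pd[OF f] S] by blast
  then obtain L where L: "\<And>i j. L i j \<ge> 0"
    "\<And>i j x y. x \<in> S \<Longrightarrow> y \<in> S \<Longrightarrow> \<bar>pd [i, j] f x - pd [i, j] f y\<bar> \<le> L i j * norm (x - y)"
    by metis
  have "norm (hessian f x *v e - hessian f y *v e)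
      \<le> (\<Sum>i\<in>UNIV. \<Sum>j\<in>UNIV. L i j) * norm (x - y) * norm e" if "x \<in> S" "y \<in> S" for x y e
  proof -
    let ?A = "hessian f x - hessian f y"
    have "norm (?A *v e) \<le> (\<Sum>i\<in>UNIV. \<Sum>j\<in>UNIV. \<bar>?A $ i $ j\<bar>) * norm e"
      by (rule norm_matrix_vector_le)
    also have "\<dots> \<le> (\<Sum>i\<in>UNIV. \<Sum>j\<in>UNIV. L i j * norm (x - y)) * norm e"
      using L(2)[OF that]
      by (intro mult_right_mono sum_mono) (simp_all add: hessian_def del: pd.simps)
    finally show ?thesis
      by (simp add: matrix_vector_mult_diff_rdistrib sum_distrib_right)
  qed
  then show ?thesis
    using L(1) by (intro exI[of _ "\<Sum>i\<in>UNIV. \<Sum>j\<in>UNIV. L i j"]) (auto intro!: sum_nonneg)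
qed

lemma hessian_bounded:
  assumes f: "smooth_on U f" and S: "compact S" "S \<subseteq> U"
  shows "\<exists>M\<ge>0. \<forall>x\<in>S. \<forall>e. norm (hessian f x *v e) \<le> M * norm e"
proof -
  have "continuous_on S (\<lambda>x. \<Sum>i\<in>UNIV. \<Sum>j\<in>UNIV. \<bar>hessian f x $ i $ j\<bar>)"
    unfolding hessian_def vec_lambda_beta
    by (intro continuous_intros smooth_on_continuous_on[OF f S(2)])
  then have "bounded ((\<lambda>x. \<Sum>i\<in>UNIV. \<Sum>j\<in>UNIV. \<bar>hessian f x $ i $ j\<bar>) ` S)"
    using S by (intro compact_imp_bounded compact_continuous_image)
  then obtain M where M: "M > 0"
    "\<And>x. x \<in> S \<Longrightarrow> norm (\<Sum>i\<in>UNIV. \<Sum>j\<in>UNIV. \<bar>hessian f x $ i $ j\<bar>) \<le> M"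
    unfolding bounded_pos by auto
  have "norm (hessian f x *v e) \<le> M * norm e" if "x \<in> S" for x e
  proof -
    have "norm (hessian f x *v e) \<le> (\<Sum>i\<in>UNIV. \<Sum>j\<in>UNIV. \<bar>hessian f x $ i $ j\<bar>) * norm e"
      by (rule norm_matrix_vector_le)
    also have "\<dots> \<le> M * norm e"
      using M(2)[OF that] by (intro mult_right_mono) auto
    finally show ?thesis .
  qed
  then show ?thesis using M(1) by (intro exI[of _ M]) auto
qed

section \<open>Estimates near the boundary\<close>

lemma frame_sum_lower_bound:
  assumes B: "orthonormal_frame p B"
    and le: "\<And>e. norm e = 1 \<Longrightarrow> norm (g e - f e) \<le> c"
  shows "(\<Sum>e\<in>B. e \<bullet> f e) - real p * c \<le> (\<Sum>e\<in>B. e \<bullet> g e)"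
proof -
  have "e \<bullet> f e - c \<le> e \<bullet> g e" if "e \<in> B" for e
  proof -
    have "\<bar>e \<bullet> (g e - f e)\<bar> \<le> norm e * norm (g e - f e)" by (rule Cauchy_Schwarz_ineq2)
    then show ?thesis
      using le[of e] orthonormal_frameD(3)[OF B that] by (simp add: inner_diff_right)
  qed
  then have "(\<Sum>e\<in>B. e \<bullet> f e - c) \<le> (\<Sum>e\<in>B. e \<bullet> g e)" by (rule sum_mono)
  then show ?thesis using orthonormal_frameD(2)[OF B] by (simp add: sum_subtractf)
qed

text \<open>Replacing \<open>A\<close> by its compression to the hyperplane plus a large multiple of the projection
  onto \<open>\<nu>\<close> gives a form with nonnegative traces on all frames; the two forms differ by
  \<open>O(\<bar>e \<bullet> \<nu>\<bar>)\<close>.\<close>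
lemma hyperplane_trace_perturbation:
  fixes A :: "'a::euclidean_space \<Rightarrow> 'a"
  assumes A: "linear A" and sa: "\<And>x y. A x \<bullet> y = x \<bullet> A y"
    and M: "\<And>x. norm (A x) \<le> M * norm x" "0 \<le> M"
    and \<nu>: "norm \<nu> = 1"
    and tang: "\<And>B. orthonormal_frame p B \<Longrightarrow> (\<forall>e\<in>B. e \<bullet> \<nu> = 0) \<Longrightarrow> 0 \<le> (\<Sum>e\<in>B. e \<bullet> A e)"
    and B: "orthonormal_frame p B"
  shows "- ((3 + real p) * M * (\<Sum>e\<in>B. \<bar>e \<bullet> \<nu>\<bar>)) \<le> (\<Sum>e\<in>B. e \<bullet> A e)"
proof -
  define P where "P x = x - (x \<bullet> \<nu>) *\<^sub>R \<nu>" for x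
  define g where "g x = P (A (P x))" for x
  \<comment> \<open>The multiple of the projection onto \<open>\<nu>\<close>: a \<open>p\<close>-set
    of eigenvectors containing \<open>\<nu>\<close> has \<open>p - 1\<close> others, each with
    eigenvalue at least \<open>- M\<close>, and \<open>L\<close> outweighs them.\<close>
  define L where "L = real p * M"
  define f where "f x = g x + (L * (x \<bullet> \<nu>)) *\<^sub>R \<nu>" for x
  have nn: "\<nu> \<bullet> \<nu> = 1" using \<nu> by (simp add: norm_eq_1)
  have Plin: "linear P"
    by (rule linearI) (simp_all add: P_def inner_add_left algebra_simps scaleR_add_left)
  then have glin: "linear g"
    using A by (intro linearI) (simp_all add: g_def linear_add linear_cmul)
  then have flin: "linear f"
    by (intro linearI)
       (simp_all add: f_def linear_add linear_cmul inner_add_left algebra_simps scaleR_add_left)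
  have Psa: "P x \<bullet> y = x \<bullet> P y" for x y
    by (simp add: P_def inner_diff_left inner_diff_right inner_commute)
  have gsa: "g x \<bullet> y = x \<bullet> g y" for x y
    by (simp add: g_def Psa sa)
  define S where "S = {x. x \<bullet> \<nu> = 0}"
  have S: "subspace S" by (auto simp: S_def subspace_def inner_add_left)
  have PS: "P x \<in> S" for x by (simp add: S_def P_def inner_diff_left nn)
  have PS_id: "P x = x" if "x \<in> S" for x using that by (simp add: S_def P_def)
  obtain T where T: "orthonormal_frame (dim S) T" "span T = S" "\<forall>b\<in>T. \<exists>m. g b = m *\<^sub>R b"
    using self_adjoint_eigenbasis[OF glin gsa S] PS by (auto simp: g_def image_subset_iff)
  have TS: "T \<subseteq> S" using T(2) span_superset by blast
  have nT: "\<nu> \<notin> T" using TS nn by (auto simp: S_def)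
  let ?T = "insert \<nu> T"
  have fT: "orthonormal_frame (Suc (dim S)) ?T"
    using T(1) TS nT \<nu>
    by (auto simp: orthonormal_frame_def pairwise_insert orthogonal_def S_def inner_commute)
  have span: "span ?T = UNIV"
  proof -
    have "x \<in> span ?T" for x
    proof -
      have "P x \<in> span ?T" using PS[of x] T(2) span_mono[of T ?T] by auto
      then have "P x + (x \<bullet> \<nu>) *\<^sub>R \<nu> \<in> span ?T"
        by (intro span_add span_scale) (auto intro: span_base)
      then show ?thesis by (simp add: P_def)
    qed
    then show ?thesis by auto
  qed
  have bA: "b \<bullet> f b = b \<bullet> A b" if "b \<in> T" for b
  proof -
    have "b \<in> S" using that TS by auto
    then show ?thesis
      using PS_id by (simp add: f_def g_def S_def flip: Psa)
  qed
  have eig: "f b = (b \<bullet> f b) *\<^sub>R b" if "b \<in> ?T" for b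
  proof -
    have "\<exists>m. f b = m *\<^sub>R b"
    proof (cases "b = \<nu>")
      case True
      have "P \<nu> = 0" by (simp add: P_def nn)
      then have "g \<nu> = 0" using A Plin by (simp add: g_def linear_0)
      then show ?thesis using True by (auto simp: f_def nn)
    next
      case False
      then have "b \<in> T" using that by auto
      then show ?thesis using T(3) TS by (auto simp: f_def S_def)
    qed
    then show ?thesis using orthonormal_frameD(4)[OF fT that] by auto
  qed
  have lower: "- M \<le> b \<bullet> A b" if "b \<in> T" for b
  proof -
    have "\<bar>b \<bullet> A b\<bar> \<le> norm b * norm (A b)" by (rule Cauchy_Schwarz_ineq2)
    then show ?thesis using M(1)[of b] orthonormal_frameD(3)[OF T(1) that] by simp
  qed
  \<comment> \<open>Ky Fan reduces this to \<open>p\<close>-subsets of the eigenbasis. Those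
    avoiding \<open>\<nu>\<close> are tangential, where \<open>f\<close> and \<open>A\<close> have
    the same quadratic form, so \<open>tang\<close> applies; those containing \<open>\<nu>\<close>
    are saved by \<open>L\<close>. When \<open>p\<close> is the full dimension only the second kind
    occurs.\<close>
  have "0 \<le> (\<Sum>e\<in>B. e \<bullet> f e)"
  proof (rule orthonormal_frame_trace_ge[OF flin fT span eig _ B])
    fix I assume I: "I \<subseteq> ?T" "card I = p"
    have finI: "finite I" using I(1) orthonormal_frameD(1)[OF fT] finite_subset by auto
    show "0 \<le> (\<Sum>b\<in>I. b \<bullet> f b)"
    proof (cases "\<nu> \<in> I")
      case False
      then have IT: "I \<subseteq> T" using I by auto
      then have "0 \<le> (\<Sum>b\<in>I. b \<bullet> A b)"
        using orthonormal_frame_subset[OF T(1) IT] I(2) TS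
        by (intro tang) (auto simp: S_def)
      then show ?thesis using bA IT by (simp add: subset_iff)
    next
      case True
      have "P \<nu> = 0" by (simp add: P_def nn)
      then have "\<nu> \<bullet> f \<nu> = L" using A Plin by (simp add: f_def g_def linear_0 nn)
      moreover have "(\<Sum>b\<in>I - {\<nu>}. - M) \<le> (\<Sum>b\<in>I - {\<nu>}. b \<bullet> f b)"
        using lower bA I(1) by (intro sum_mono) auto
      moreover have "real (card (I - {\<nu>})) * M \<le> L"
        unfolding L_def using I(2) M(2) finI by (intro mult_right_mono) (auto simp: card_Diff1_le)
      ultimately show ?thesis using True finI by (simp add: sum.remove)
    qed
  qed
  also have "\<dots> \<le> (\<Sum>e\<in>B. e \<bullet> A e + (3 + real p) * M * \<bar>e \<bullet> \<nu>\<bar>)"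
  proof (rule sum_mono)
    fix e assume "e \<in> B"
    then have e: "norm e = 1" using orthonormal_frameD[OF B] by auto
    define s where "s = e \<bullet> \<nu>"
    have s1: "\<bar>s\<bar> \<le> 1" using Cauchy_Schwarz_ineq2[of e \<nu>] e \<nu> by (simp add: s_def)
    \<comment> \<open>Turns quadratic errors into linear ones. Compared with \<open>A\<close>, the
      form \<open>f\<close> has two cross terms and one term in
      \<open>\<nu> \<bullet> A \<nu>\<close>, each at most \<open>M * \<bar>s\<bar>\<close>, and the
      penalty, at most \<open>real p * M * \<bar>s\<bar>\<close>; hence the factor
      \<open>3 + real p\<close>.\<close>
    have s2: "s\<^sup>2 \<le> \<bar>s\<bar>"
      using s1 mult_left_le[of "\<bar>s\<bar>" "\<bar>s\<bar>"] by (simp add: power2_eq_square flip: abs_mult)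
    have Cd: "\<bar>x \<bullet> A y\<bar> \<le> M" if "norm x = 1" "norm y = 1" for x y
      using Cauchy_Schwarz_ineq2[of x "A y"] M(1)[of y] that by simp
    have ef: "e \<bullet> f e = P e \<bullet> A (P e) + L * s\<^sup>2"
      by (simp add: f_def g_def inner_add_right s_def power2_eq_square flip: Psa)
    have sym: "e \<bullet> A \<nu> = \<nu> \<bullet> A e" by (metis sa inner_commute)
    have Pe: "P e \<bullet> A (P e) = e \<bullet> A e - 2 * (s * (\<nu> \<bullet> A e)) + s\<^sup>2 * (\<nu> \<bullet> A \<nu>)"
      using A by (simp add: P_def s_def[symmetric] linear_diff linear_cmul inner_diff_left
            inner_diff_right power2_eq_square sym right_diff_distrib)
    have "\<bar>s * (\<nu> \<bullet> A e)\<bar> \<le> \<bar>s\<bar> * M"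
      unfolding abs_mult using Cd[OF \<nu> e] by (intro mult_left_mono) auto
    then have 1: "- (s * (\<nu> \<bullet> A e)) \<le> \<bar>s\<bar> * M" by (rule abs_le_D2)
    have "s\<^sup>2 * (\<nu> \<bullet> A \<nu>) \<le> s\<^sup>2 * M"
      using Cd[OF \<nu> \<nu>] by (intro mult_left_mono) auto
    also have "\<dots> \<le> \<bar>s\<bar> * M" using s2 M(2) by (intro mult_right_mono) auto
    finally have 2: "s\<^sup>2 * (\<nu> \<bullet> A \<nu>) \<le> \<bar>s\<bar> * M" .
    have 3: "L * s\<^sup>2 \<le> real p * M * \<bar>s\<bar>"
      unfolding L_def using s2 M(2) by (intro mult_left_mono) auto
    have "(3 + real p) * M * \<bar>s\<bar> = 3 * (\<bar>s\<bar> * M) + real p * M * \<bar>s\<bar>"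
      by (simp add: algebra_simps)
    then show "e \<bullet> f e \<le> e \<bullet> A e + (3 + real p) * M * \<bar>e \<bullet> \<nu>\<bar>"
      using ef Pe 1 2 3 unfolding s_def[symmetric] by linarith
  qed
  finally show ?thesis
    by (simp add: sum.distrib sum_distrib_left)
qed

text \<open>Takes the span of \<open>B\<close> as the subspace in the definition. The normalising
  factor \<open>1 / norm (grad r y)\<close> is positive and drops out, leaving the Hessian
  itself.\<close>

lemma p_convex_boundary_trace:
  assumes conv: "p_convex_boundary p \<Omega> r" and def: "defining_function \<Omega> r"
    and y: "y \<in> frontier \<Omega>"
    and B: "orthonormal_frame p B" "\<forall>e\<in>B. e \<bullet> grad r y = 0"
  shows "0 \<le> (\<Sum>e\<in>B. e \<bullet> (hessian r y *v e))"
proof -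
  note F = orthonormal_frameD[OF B(1)]
  have sub: "span B \<subseteq> tangent_space r y"
    using B(2)
    by (intro span_minimal) (auto simp: tangent_space_def subspace_def inner_add_left)
  have "dim (span B) = p"
    using F(2) dim_span_eq_card_independent[OF orthonormal_frame_independent[OF B(1)]] by simp
  moreover have "orthonormal_basis (span B) B"
    using B(1) span_superset unfolding orthonormal_basis_def orthonormal_frame_def by blast
  ultimately have "0 \<le> (\<Sum>e\<in>B. second_fundamental_form r y e e)"
    using conv y sub subspace_span[of B] unfolding p_convex_boundary_def by blast
  also have "\<dots> = (\<Sum>e\<in>B. e \<bullet> (hessian r y *v e)) / norm (grad r y)"
    by (simp add: second_fundamental_form_def sum_divide_distrib)
  finally have "0 \<le> (\<Sum>e\<in>B. e \<bullet> (hessian r y *v e)) / norm (grad r y)" .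
  moreover have "norm (grad r y) > 0"
    using def y by (auto simp: defining_function_def)
  ultimately show ?thesis by (simp add: zero_le_divide_iff)
qed

lemma isCont_grad: "smooth_on U f \<Longrightarrow> x \<in> U \<Longrightarrow> isCont (grad f) x"
  by (meson continuous_on_eq_continuous_at continuous_on_grad order_refl smooth_on_def)

lemma isCont_smooth_on: "smooth_on U f \<Longrightarrow> x \<in> U \<Longrightarrow> isCont f x"
  using smooth_on_has_derivative has_derivative_continuous by blast

text \<open>Moving from \<open>x\<close> in the direction of steepest ascent at the boundary point, the defining
  function vanishes after a distance comparable to \<open>\<bar>r x\<bar>\<close>.\<close>
lemma exit_point:
  assumes r: "smooth_on U r" and def: "defining_function \<Omega> r"
    and v: "norm v = 1" and S: "cball x0 d \<subseteq> U"
    and grad: "\<And>z. z \<in> cball x0 d \<Longrightarrow> c \<le> v \<bullet> grad r z" and c: "0 < c"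
    and x: "x \<in> \<Omega>" "dist x0 x + \<bar>r x\<bar> / c \<le> d"
  obtains y where "y \<in> frontier \<Omega>" "y \<in> cball x0 d" "norm (x - y) \<le> \<bar>r x\<bar> / c"
proof -
  have rx: "r x < 0" using def x by (simp add: defining_function_def)
  \<comment> \<open>Along \<open>v\<close> the function \<open>r\<close> grows at rate at least
    \<open>c\<close>, so it climbs from \<open>r x\<close> to a nonnegative value within length
    \<open>t\<close>.\<close>
  define t where "t = \<bar>r x\<bar> / c"
  have t: "t > 0" unfolding t_def using rx c by (intro divide_pos_pos) auto
  have near: "x + s *\<^sub>R v \<in> cball x0 d" if "0 \<le> s" "s \<le> t" for s
  proof -
    have "dist x0 (x + s *\<^sub>R v) \<le> dist x0 x + dist x (x + s *\<^sub>R v)" by (rule dist_triangle)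
    also have "dist x (x + s *\<^sub>R v) = s" using that v by (simp add: dist_norm)
    finally show ?thesis using that x(2) by (simp add: t_def)
  qed
  have "\<exists>z>0. z < t \<and> r (x + t *\<^sub>R v) - r (x + 0 *\<^sub>R v) = (t - 0) * (v \<bullet> grad r (x + z *\<^sub>R v))"
    using near S t
    by (intro MVT2[where f = "\<lambda>s. r (x + s *\<^sub>R v)"] smooth_on_has_field_derivative_line[OF r]) auto
  then obtain z where z: "0 < z" "z < t" "r (x + t *\<^sub>R v) - r x = t * (v \<bullet> grad r (x + z *\<^sub>R v))"
    by auto
  have "t * c \<le> t * (v \<bullet> grad r (x + z *\<^sub>R v))"
    using t z near by (intro mult_left_mono grad) auto
  moreover have "t * c = - r x" using c rx by (simp add: t_def)
  ultimately have "0 \<le> r (x + t *\<^sub>R v)" using z(3) by simp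
  then have out: "x + t *\<^sub>R v \<notin> \<Omega>" using def by (force simp: defining_function_def)
  \<comment> \<open>The end of the segment is only known to lie outside \<open>\<Omega>\<close>; the
    boundary point may come earlier, which only improves the distance bound.\<close>
  have "closed_segment x (x + t *\<^sub>R v) \<inter> frontier \<Omega> \<noteq> {}"
    using x out by (intro connected_Int_frontier) auto
  then obtain y where y: "y \<in> closed_segment x (x + t *\<^sub>R v)" "y \<in> frontier \<Omega>" by auto
  then obtain u where u: "0 \<le> u" "u \<le> 1" "y = x + (u * t) *\<^sub>R v"
    by (auto simp: in_segment algebra_simps)
  have ut: "0 \<le> u * t" "u * t \<le> t" using u t by (auto simp: mult_left_le_one_le)
  then have "norm (x - y) \<le> t" using u(3) v by simp
  then show thesis using that[of y] y near[OF ut] u(3) by (simp add: t_def)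
qed

text \<open>The frame \<open>B\<close> stays the same while the base point moves from
  \<open>x\<close> to a boundary point \<open>y\<close>, so only the gradient and the Hessian of
  \<open>r\<close> change, both by a Lipschitz amount of order \<open>|r x|\<close>.\<close>

lemma boundary_hessian_estimate:
  fixes \<Omega> :: "(real ^ 'n) set"
  assumes r: "smooth_on U r" "closure \<Omega> \<subseteq> U" and def: "defining_function \<Omega> r"
    and conv: "p_convex_boundary p \<Omega> r" and x0: "x0 \<in> frontier \<Omega>"
  shows "\<exists>\<epsilon>>0. \<exists>C>0. \<forall>x\<in>\<Omega> \<inter> ball x0 \<epsilon>. \<forall>B. orthonormal_frame p B \<longrightarrow>
    - C * (\<bar>r x\<bar> + (\<Sum>e\<in>B. \<bar>e \<bullet> grad r x\<bar>)) \<le> (\<Sum>e\<in>B. e \<bullet> (hessian r x *v e))"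
proof -
  have U: "open U" "x0 \<in> U" using r x0 by (auto simp: smooth_on_def frontier_def)
  have g0: "grad r x0 \<noteq> 0" "r x0 = 0" using def x0 by (auto simp: defining_function_def)
  \<comment> \<open>Half the gradient norm leaves room for continuity:
    \<open>v \<bullet> grad r\<close> stays above \<open>c\<close> near \<open>x0\<close>.\<close>
  define c where "c = norm (grad r x0) / 2"
  define v where "v = grad r x0 /\<^sub>R norm (grad r x0)"
  have c: "c > 0" and v: "norm v = 1" using g0 by (auto simp: c_def v_def)
  have "v \<bullet> grad r x0 = 2 * c"
    using g0 by (simp add: c_def v_def power2_norm_eq_inner[symmetric] power2_eq_square)
  then have "c < v \<bullet> grad r x0" using c by simp
  moreover have "isCont (\<lambda>z. v \<bullet> grad r z) x0"
    using isCont_grad[OF r(1) U(2)] by (intro continuous_intros)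
  then have "((\<lambda>z. v \<bullet> grad r z) \<longlongrightarrow> v \<bullet> grad r x0) (nhds x0)"
    unfolding isCont_def by (rule tendsto_at_iff_tendsto_nhds[THEN iffD1])
  ultimately have "eventually (\<lambda>z. c < v \<bullet> grad r z) (nhds x0)"
    by (metis order_tendstoD(1))
  moreover have "eventually (\<lambda>z. z \<in> U) (nhds x0)" using U by (rule eventually_nhds_in_open)
  ultimately have "eventually (\<lambda>z. c < v \<bullet> grad r z \<and> z \<in> U) (nhds x0)"
    by (rule eventually_conj)
  then obtain d' where d': "d' > 0" "\<And>z. dist z x0 < d' \<Longrightarrow> c < v \<bullet> grad r z \<and> z \<in> U"
    unfolding eventually_nhds_metric by blast
  \<comment> \<open>Halved so that the closed ball \<open>S\<close> lies in the open ball just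
    found; \<open>S\<close> is compact and convex, as the Lipschitz bounds require.\<close>
  define d where "d = d' / 2"
  define S where "S = cball x0 d"
  have "c < v \<bullet> grad r z \<and> z \<in> U" if "z \<in> S" for z
    using that d' by (intro d'(2)) (auto simp: S_def d_def dist_commute)
  then have d: "d > 0" and S: "\<And>z. z \<in> S \<Longrightarrow> c \<le> v \<bullet> grad r z" "S \<subseteq> U" "compact S" "convex S"
    using d'(1) by (auto simp: d_def S_def less_imp_le)
  have "isCont r x0" using isCont_smooth_on r(1) U(2) by blast
  then have "(r \<longlongrightarrow> r x0) (nhds x0)" by (simp add: isCont_def tendsto_at_iff_tendsto_nhds)
  moreover have "c * d / 2 > 0" using c d by simp
  ultimately have "eventually (\<lambda>z. dist (r z) (r x0) < c * d / 2) (nhds x0)" by (rule tendstoD)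
  then obtain d2 where d2: "d2 > 0" "\<And>z. dist z x0 < d2 \<Longrightarrow> \<bar>r z\<bar> < c * d / 2"
    unfolding eventually_nhds_metric by (auto simp: g0)
  \<comment> \<open>Half of \<open>d\<close> is spent on the distance from \<open>x0\<close> to
    \<open>x\<close>; \<open>d2\<close> keeps \<open>\<bar>r x\<bar> / c\<close> within the other
    half, so that \<open>exit_point\<close> applies.\<close>
  define \<epsilon> where "\<epsilon> = min (d / 2) d2"
  obtain L1 where L1: "L1 \<ge> 0" "\<And>x y e. x \<in> S \<Longrightarrow> y \<in> S \<Longrightarrow>
      norm (hessian r x *v e - hessian r y *v e) \<le> L1 * norm (x - y) * norm e"
    using hessian_lipschitz[OF r(1) S(3,4,2)] by blast
  obtain L2 where L2: "L2 \<ge> 0" "\<And>x y. x \<in> S \<Longrightarrow> y \<in> S \<Longrightarrow>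
      norm (grad r x - grad r y) \<le> L2 * norm (x - y)"
    using grad_lipschitz[OF r(1) S(3,4,2)] by blast
  obtain M where M: "M \<ge> 0" "\<And>x e. x \<in> S \<Longrightarrow> norm (hessian r x *v e) \<le> M * norm e"
    using hessian_bounded[OF r(1) S(3,2)] by blast
  \<comment> \<open>The factor from \<open>hyperplane_trace_perturbation\<close> after the unit
    normal is replaced by \<open>grad r y\<close>, whose norm is at least \<open>c\<close>.\<close>
  define Q where "Q = (3 + real p) * M / c"
  have Q: "Q \<ge> 0" using M c by (simp add: Q_def)
  \<comment> \<open>The cost of the move from \<open>y\<close> to \<open>x\<close> on
    \<open>p\<close> vectors: \<open>L1\<close> for the Hessian and, through \<open>Q\<close>,
    \<open>L2\<close> for the gradient, times the distance
    \<open>\<bar>r x\<bar> / c\<close>.\<close>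
  define R where "R = (real p * L1 + Q * (real p * L2)) / c"
  have R: "R \<ge> 0" using L1 L2 Q c by (simp add: R_def)
  have "- (Q + R + 1) * (\<bar>r x\<bar> + (\<Sum>e\<in>B. \<bar>e \<bullet> grad r x\<bar>)) \<le> (\<Sum>e\<in>B. e \<bullet> (hessian r x *v e))"
    if x: "x \<in> \<Omega>" "x \<in> ball x0 \<epsilon>" and B: "orthonormal_frame p B" for x B
  proof -
    note F = orthonormal_frameD[OF B]
    let ?s = "\<Sum>e\<in>B. \<bar>e \<bullet> grad r x\<bar>"
    have s: "?s \<ge> 0" by (simp add: sum_nonneg)
    define t where "t = \<bar>r x\<bar> / c"
    have rx: "\<bar>r x\<bar> < c * d / 2" using x by (intro d2) (simp add: \<epsilon>_def dist_commute)
    then have "t \<le> d / 2" using c by (simp add: t_def field_simps)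
    moreover have "dist x0 x \<le> d / 2" using x by (simp add: \<epsilon>_def)
    ultimately have "dist x0 x + \<bar>r x\<bar> / c \<le> d" unfolding t_def by linarith
    then obtain y where y: "y \<in> frontier \<Omega>" "y \<in> S" "norm (x - y) \<le> t"
      using exit_point[OF r(1) def v S(2)[unfolded S_def] S(1)[unfolded S_def] c x(1)]
      unfolding S_def t_def by blast
    have xS: "x \<in> S" using x d by (simp add: S_def \<epsilon>_def)
    have ng: "c \<le> norm (grad r y)"
      using S(1)[OF y(2)] Cauchy_Schwarz_ineq2[of v "grad r y"] v by simp
    then have ng0: "grad r y \<noteq> 0" using c by auto
    define \<nu> where "\<nu> = grad r y /\<^sub>R norm (grad r y)"
    have sym: "transpose (hessian r y) = hessian r y"
      using transpose_hessian[OF r(1)] y(2) S(2) by blast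
    have "- ((3 + real p) * M * (\<Sum>e\<in>B. \<bar>e \<bullet> \<nu>\<bar>)) \<le> (\<Sum>e\<in>B. e \<bullet> (hessian r y *v e))"
    proof (rule hyperplane_trace_perturbation[OF _ _ _ M(1) _ _ B])
      show "norm \<nu> = 1" using ng0 by (simp add: \<nu>_def)
      show "0 \<le> (\<Sum>e\<in>B'. e \<bullet> (hessian r y *v e))"
        if "orthonormal_frame p B'" "\<forall>e\<in>B'. e \<bullet> \<nu> = 0" for B'
        using that ng0
        by (intro p_convex_boundary_trace[OF conv def y(1)]) (auto simp: \<nu>_def)
    qed (use M(2)[OF y(2)] symmetric_matrix_inner[OF sym] in auto)
    moreover have "(3 + real p) * M * (\<Sum>e\<in>B. \<bar>e \<bullet> \<nu>\<bar>) \<le> Q * (?s + real p * (L2 * t))"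
    proof -
      have "\<bar>e \<bullet> \<nu>\<bar> \<le> (\<bar>e \<bullet> grad r x\<bar> + L2 * t) / c" if "e \<in> B" for e
      proof -
        have "\<bar>e \<bullet> \<nu>\<bar> = \<bar>e \<bullet> grad r y\<bar> / norm (grad r y)"
          by (simp add: \<nu>_def abs_mult divide_inverse)
        also have "\<dots> \<le> \<bar>e \<bullet> grad r y\<bar> / c"
          using ng ng0 c by (intro divide_left_mono) auto
        also have "\<dots> \<le> (\<bar>e \<bullet> grad r x\<bar> + L2 * t) / c"
        proof (rule divide_right_mono)
          have "\<bar>e \<bullet> (grad r x - grad r y)\<bar> \<le> norm e * norm (grad r x - grad r y)"
            by (rule Cauchy_Schwarz_ineq2)
          also have "\<dots> \<le> L2 * norm (x - y)" using F(3)[OF that] L2(2)[OF xS y(2)] by simp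
          also have "\<dots> \<le> L2 * t" using L2(1) y(3) by (intro mult_left_mono)
          finally show "\<bar>e \<bullet> grad r y\<bar> \<le> \<bar>e \<bullet> grad r x\<bar> + L2 * t"
            by (simp add: inner_diff_right)
        qed (use c in simp)
        finally show ?thesis .
      qed
      then have "(\<Sum>e\<in>B. \<bar>e \<bullet> \<nu>\<bar>) \<le> (\<Sum>e\<in>B. (\<bar>e \<bullet> grad r x\<bar> + L2 * t) / c)"
        by (rule sum_mono)
      also have "\<dots> = (?s + real p * (L2 * t)) / c"
        using F(2) by (simp add: sum.distrib flip: sum_divide_distrib)
      finally have "(3 + real p) * M * (\<Sum>e\<in>B. \<bar>e \<bullet> \<nu>\<bar>)
          \<le> (3 + real p) * M * ((?s + real p * (L2 * t)) / c)"
        using M by (intro mult_left_mono) auto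
      then show ?thesis by (simp add: Q_def)
    qed
    moreover have "(\<Sum>e\<in>B. e \<bullet> (hessian r y *v e)) - real p * (L1 * t)
        \<le> (\<Sum>e\<in>B. e \<bullet> (hessian r x *v e))"
    proof (rule frame_sum_lower_bound[OF B])
      fix e :: "real ^ 'n" assume "norm e = 1"
      then have "norm (hessian r x *v e - hessian r y *v e) \<le> L1 * norm (x - y)"
        using L1(2)[OF xS y(2), of e] by simp
      also have "\<dots> \<le> L1 * t" using L1(1) y(3) by (intro mult_left_mono)
      finally show "norm (hessian r x *v e - hessian r y *v e) \<le> L1 * t" .
    qed
    ultimately have "- (Q * (?s + real p * (L2 * t)) + real p * (L1 * t))
        \<le> (\<Sum>e\<in>B. e \<bullet> (hessian r x *v e))" by linarith
    also have "Q * (?s + real p * (L2 * t)) + real p * (L1 * t) = Q * ?s + R * \<bar>r x\<bar>"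
      by (simp add: R_def t_def add_divide_distrib algebra_simps)
    finally have "- (Q * ?s + R * \<bar>r x\<bar>) \<le> (\<Sum>e\<in>B. e \<bullet> (hessian r x *v e))" .
    moreover have "0 \<le> Q * \<bar>r x\<bar>" "0 \<le> R * ?s" using Q R s by auto
    moreover have "(Q + R + 1) * (\<bar>r x\<bar> + ?s)
        = (Q * ?s + R * \<bar>r x\<bar>) + Q * \<bar>r x\<bar> + R * ?s + \<bar>r x\<bar> + ?s"
      by (simp add: algebra_simps)
    ultimately show ?thesis using s abs_ge_zero[of "r x"] unfolding mult_minus_left by linarith
  qed
  moreover have "\<epsilon> > 0" using d d2 by (simp add: \<epsilon>_def)
  moreover have "Q + R + 1 > 0" using Q R by simp
  ultimately show ?thesis by (intro exI[of _ \<epsilon>] exI[of _ "Q + R + 1"] conjI ballI allI impI) auto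
qed

text \<open>Near an interior point \<open>|r|\<close> is bounded below, so a large multiple of it
  dominates the bounded Hessian whatever its sign.\<close>

lemma interior_hessian_estimate:
  fixes \<Omega> :: "(real ^ 'n) set"
  assumes r: "smooth_on U r" "closure \<Omega> \<subseteq> U" and def: "defining_function \<Omega> r"
    and x0: "x0 \<in> \<Omega>"
  shows "\<exists>\<epsilon>>0. \<exists>C>0. \<forall>x\<in>\<Omega> \<inter> ball x0 \<epsilon>. \<forall>B. orthonormal_frame p B \<longrightarrow>
    - C * (\<bar>r x\<bar> + (\<Sum>e\<in>B. \<bar>e \<bullet> grad r x\<bar>)) \<le> (\<Sum>e\<in>B. e \<bullet> (hessian r x *v e))"
proof -
  have U: "open U" "x0 \<in> U" using r x0 closure_subset by (auto simp: smooth_on_def)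
  have rx0: "r x0 < 0" using def x0 by (simp add: defining_function_def)
  obtain d where d: "d > 0" "cball x0 d \<subseteq> U" using U open_contains_cball by blast
  obtain M where M: "M \<ge> 0" "\<And>x e. x \<in> cball x0 d \<Longrightarrow> norm (hessian r x *v e) \<le> M * norm e"
    using hessian_bounded[OF r(1) _ d(2)] by auto
  define h where "h = - r x0 / 2"
  have h: "h > 0" using rx0 by (simp add: h_def)
  have "isCont r x0" using isCont_smooth_on r(1) U(2) by blast
  then have "(r \<longlongrightarrow> r x0) (nhds x0)" by (simp add: isCont_def tendsto_at_iff_tendsto_nhds)
  then have "eventually (\<lambda>z. r z < - h) (nhds x0)"
    using rx0 by (intro order_tendstoD(2)) (auto simp: h_def)
  then obtain d2 where d2: "d2 > 0" "\<And>z. dist z x0 < d2 \<Longrightarrow> r z < - h"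
    unfolding eventually_nhds_metric by auto
  define C where "C = real p * M / h + 1"
  have C: "C > 0" using M h by (simp add: C_def add_nonneg_pos)
  have "- C * (\<bar>r x\<bar> + (\<Sum>e\<in>B. \<bar>e \<bullet> grad r x\<bar>)) \<le> (\<Sum>e\<in>B. e \<bullet> (hessian r x *v e))"
    if x: "x \<in> ball x0 (min d d2)" and B: "orthonormal_frame p B" for x B
  proof -
    have "h \<le> \<bar>r x\<bar>" using d2(2)[of x] x by (simp add: dist_commute)
    moreover have "0 \<le> (\<Sum>e\<in>B. \<bar>e \<bullet> grad r x\<bar>)" by (simp add: sum_nonneg)
    ultimately have "h \<le> \<bar>r x\<bar> + (\<Sum>e\<in>B. \<bar>e \<bullet> grad r x\<bar>)" by linarith
    then have "C * h \<le> C * (\<bar>r x\<bar> + (\<Sum>e\<in>B. \<bar>e \<bullet> grad r x\<bar>))"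
      using C by (intro mult_left_mono) auto
    moreover have "real p * M \<le> C * h" using h by (simp add: C_def field_simps)
    moreover have "(\<Sum>e\<in>B. e \<bullet> 0) - real p * M \<le> (\<Sum>e\<in>B. e \<bullet> (hessian r x *v e))"
    proof (rule frame_sum_lower_bound[OF B])
      show "norm (hessian r x *v e - 0) \<le> M" if "norm e = 1" for e
        using M(2)[of x e] x that by simp
    qed
    ultimately show ?thesis by simp
  qed
  then show ?thesis
    using d(1) d2(1) C
    by (intro exI[of _ "min d d2"] exI[of _ C] conjI ballI allI impI) auto
qed

section \<open>Uniform constants by compactness\<close>

text \<open>A finite subcover leaves finitely many constants, and \<open>mono\<close> allows passing
  to their maximum; the inserted \<open>1\<close> keeps it defined for an empty subcover.\<close>

lemma compact_uniform_constant:
  fixes S :: "'a::metric_space set" and P :: "real \<Rightarrow> 'a \<Rightarrow> bool"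
  assumes S: "compact S"
    and loc: "\<And>x0. x0 \<in> S \<Longrightarrow> \<exists>\<epsilon>>0. \<exists>C>0. \<forall>x\<in>ball x0 \<epsilon>. P C x"
    and mono: "\<And>C C' x. P C x \<Longrightarrow> C \<le> C' \<Longrightarrow> P C' x"
  shows "\<exists>C>0. \<forall>x\<in>S. P C x"
proof -
  obtain \<epsilon> C where *: "\<And>x0. x0 \<in> S \<Longrightarrow> \<epsilon> x0 > 0 \<and> C x0 > (0::real) \<and> (\<forall>x\<in>ball x0 (\<epsilon> x0). P (C x0) x)"
    using loc by metis
  obtain D where D: "D \<subseteq> S" "finite D" "S \<subseteq> (\<Union>x\<in>D. ball x (\<epsilon> x))"
  proof (rule compactE_image[OF S, of S "\<lambda>x. ball x (\<epsilon> x)"])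
    show "S \<subseteq> (\<Union>x\<in>S. ball x (\<epsilon> x))" using * by fastforce
  qed auto
  define K where "K = Max (insert 1 (C ` D))"
  have "P K x" if x: "x \<in> S" for x
  proof -
    obtain y where y: "y \<in> D" "x \<in> ball y (\<epsilon> y)" using D(3) x by blast
    then have "P (C y) x" using * D(1) by blast
    moreover have "C y \<le> K" using y D(2) by (auto simp: K_def)
    ultimately show ?thesis by (rule mono)
  qed
  moreover have "K > 0" unfolding K_def using D(2) by (subst Max_gr_iff) auto
  ultimately show ?thesis by blast
qed

lemma hessian_estimate:
  fixes \<Omega> :: "(real ^ 'n) set"
  assumes \<Omega>: "bounded \<Omega>" "open \<Omega>" and r: "smooth_on_closure \<Omega> r" "defining_function \<Omega> r"
    and conv: "p_convex_boundary p \<Omega> r"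
  shows "\<exists>C>0. \<forall>x\<in>\<Omega>. \<forall>B. orthonormal_frame p B \<longrightarrow>
    - C * (\<bar>r x\<bar> + (\<Sum>e\<in>B. \<bar>e \<bullet> grad r x\<bar>)) \<le> (\<Sum>e\<in>B. e \<bullet> (hessian r x *v e))"
proof -
  obtain U where U: "smooth_on U r" "closure \<Omega> \<subseteq> U"
    using r(1) by (auto simp: smooth_on_closure_def)
  \<comment> \<open>Membership in \<open>\<Omega>\<close> is part of the predicate because
    compactness needs the closure, while the estimate concerns \<open>\<Omega>\<close>; boundary
    points serve only as centres of balls.\<close>
  let ?P = "\<lambda>C x. x \<in> \<Omega> \<longrightarrow> (\<forall>B :: (real ^ 'n) set. orthonormal_frame p B \<longrightarrow>
    - C * (\<bar>r x\<bar> + (\<Sum>e\<in>B. \<bar>e \<bullet> grad r x\<bar>)) \<le> (\<Sum>e\<in>B. e \<bullet> (hessian r x *v e)))"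
  have "\<exists>C>0. \<forall>x\<in>closure \<Omega>. ?P C x"
  proof (rule compact_uniform_constant)
    show "compact (closure \<Omega>)" using \<Omega>(1) by (simp add: compact_closure)
    fix x0 assume "x0 \<in> closure \<Omega>"
    then consider "x0 \<in> \<Omega>" | "x0 \<in> frontier \<Omega>"
      using \<Omega>(2) by (auto simp: frontier_def interior_open)
    then show "\<exists>\<epsilon>>0. \<exists>C>0. \<forall>x\<in>ball x0 \<epsilon>. ?P C x"
    proof cases
      case 1
      from interior_hessian_estimate[OF U r(2) 1] show ?thesis by (simp add: Int_iff) blast
    next
      case 2
      from boundary_hessian_estimate[OF U r(2) conv 2] show ?thesis by (simp add: Int_iff) blast
    qed
  next
    fix C C' :: real and x
    assume P: "?P C x" and "C \<le> C'"
    show "?P C' x"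
    proof (intro impI allI)
      fix B :: "(real ^ 'n) set" assume x: "x \<in> \<Omega>" and B: "orthonormal_frame p B"
      have "C * (\<bar>r x\<bar> + (\<Sum>e\<in>B. \<bar>e \<bullet> grad r x\<bar>)) \<le> C' * (\<bar>r x\<bar> + (\<Sum>e\<in>B. \<bar>e \<bullet> grad r x\<bar>))"
        using \<open>C \<le> C'\<close> by (intro mult_right_mono) (auto intro: add_nonneg_nonneg sum_nonneg)
      then show "- C' * (\<bar>r x\<bar> + (\<Sum>e\<in>B. \<bar>e \<bullet> grad r x\<bar>)) \<le> (\<Sum>e\<in>B. e \<bullet> (hessian r x *v e))"
        using P x B by fastforce
    qed
  qed
  then show ?thesis using closure_subset by blast
qed

lemma strictly_p_psh_uniform:
  fixes \<Omega> :: "(real ^ 'n) set"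
  assumes \<Omega>: "bounded \<Omega>" and \<phi>: "smooth_on_closure \<Omega> \<phi>" "strictly_p_psh_on p (closure \<Omega>) \<phi>"
  shows "\<exists>a>0. \<forall>x\<in>closure \<Omega>. \<forall>B. orthonormal_frame p B \<longrightarrow> a \<le> (\<Sum>e\<in>B. e \<bullet> (hessian \<phi> x *v e))"
proof -
  obtain U where U: "smooth_on U \<phi>" "closure \<Omega> \<subseteq> U"
    using \<phi>(1) by (auto simp: smooth_on_closure_def)
  \<comment> \<open>The lower bound \<open>a\<close> enters through \<open>C = 1 / a\<close>, so
    that the claim weakens as \<open>C\<close> grows; the second conjunct is what makes this
    monotonicity valid.\<close>
  let ?P = "\<lambda>C x. \<forall>B :: (real ^ 'n) set. orthonormal_frame p B \<longrightarrow> 1 \<le> C * (\<Sum>e\<in>B. e \<bullet> (hessian \<phi> x *v e))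
    \<and> 0 \<le> (\<Sum>e\<in>B. e \<bullet> (hessian \<phi> x *v e))"
  have "\<exists>C>0. \<forall>x\<in>closure \<Omega>. ?P C x"
  proof (rule compact_uniform_constant)
    show "compact (closure \<Omega>)" using \<Omega>(1) by (simp add: compact_closure)
    fix x0 assume x0: "x0 \<in> closure \<Omega>"
    then have "p_pos_def p (hessian \<phi> x0)" using \<phi>(2) by (simp add: strictly_p_psh_on_def)
    then obtain m where m: "0 < m"
      "\<And>B. orthonormal_frame p B \<Longrightarrow> m \<le> (\<Sum>e\<in>B. e \<bullet> (hessian \<phi> x0 *v e))"
      using p_pos_def_frame_trace by blast
    have "open U" "x0 \<in> U" using U x0 by (auto simp: smooth_on_def)
    then obtain d where d: "d > 0" "cball x0 d \<subseteq> U" using open_contains_cball by blast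
    obtain L where L: "L \<ge> 0" "\<And>x y e. x \<in> cball x0 d \<Longrightarrow> y \<in> cball x0 d \<Longrightarrow>
        norm (hessian \<phi> x *v e - hessian \<phi> y *v e) \<le> L * norm (x - y) * norm e"
      using hessian_lipschitz[OF U(1) compact_cball convex_cball d(2)] by blast
    \<comment> \<open>Small enough that the variation of the trace, at most
      \<open>real p * L * \<epsilon>\<close>, uses up at most half of \<open>m\<close>; the
      \<open>1\<close> guards against division by zero.\<close>
    define \<epsilon> where "\<epsilon> = min d (m / (2 * (real p * L + 1)))"
    have pL: "real p * L + 1 > 0" using L by (simp add: add_nonneg_pos)
    have eps: "\<epsilon> > 0" using d m pL by (simp add: \<epsilon>_def)
    have "?P (2 / m) x" if x: "x \<in> ball x0 \<epsilon>" for x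
    proof (intro allI impI)
      fix B :: "(real ^ 'n) set" assume B: "orthonormal_frame p B"
      have "(\<Sum>e\<in>B. e \<bullet> (hessian \<phi> x0 *v e)) - real p * (L * \<epsilon>) \<le> (\<Sum>e\<in>B. e \<bullet> (hessian \<phi> x *v e))"
      proof (rule frame_sum_lower_bound[OF B])
        fix e :: "real ^ 'n" assume "norm e = 1"
        then have "norm (hessian \<phi> x *v e - hessian \<phi> x0 *v e) \<le> L * norm (x - x0)"
          using L(2)[of x x0 e] x d by (simp add: \<epsilon>_def)
        also have "\<dots> \<le> L * \<epsilon>"
          using x L(1) by (intro mult_left_mono) (auto simp: dist_norm norm_minus_commute)
        finally show "norm (hessian \<phi> x *v e - hessian \<phi> x0 *v e) \<le> L * \<epsilon>" .
      qed
      moreover have "real p * (L * \<epsilon>) \<le> m / 2"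
      proof -
        have "real p * L * \<epsilon> \<le> (real p * L + 1) * \<epsilon>" using eps by simp
        also have "\<dots> \<le> (real p * L + 1) * (m / (2 * (real p * L + 1)))"
          using pL by (intro mult_left_mono) (auto simp: \<epsilon>_def)
        also have "\<dots> = m / 2" using pL by (simp add: field_simps)
        finally show ?thesis by simp
      qed
      ultimately have "m / 2 \<le> (\<Sum>e\<in>B. e \<bullet> (hessian \<phi> x *v e))" using m(2)[OF B] by linarith
      then show "1 \<le> 2 / m * (\<Sum>e\<in>B. e \<bullet> (hessian \<phi> x *v e)) \<and> 0 \<le> (\<Sum>e\<in>B. e \<bullet> (hessian \<phi> x *v e))"
        using m(1) by (simp add: field_simps)
    qed
    then have "\<forall>x\<in>ball x0 \<epsilon>. ?P (2 / m) x" by blast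
    moreover have "2 / m > 0" using m(1) by simp
    ultimately show "\<exists>\<epsilon>>0. \<exists>C>0. \<forall>x\<in>ball x0 \<epsilon>. ?P C x"
      using eps by blast
  next
    fix C C' :: real and x
    assume P: "?P C x" and "C \<le> C'"
    show "?P C' x"
    proof (intro impI allI)
      fix B :: "(real ^ 'n) set" assume B: "orthonormal_frame p B"
      let ?t = "\<Sum>e\<in>B. e \<bullet> (hessian \<phi> x *v e)"
      have "1 \<le> C * ?t" "0 \<le> ?t" using P B by auto
      moreover have "C * ?t \<le> C' * ?t"
        using \<open>C \<le> C'\<close> \<open>0 \<le> ?t\<close> by (rule mult_right_mono)
      ultimately show "1 \<le> C' * ?t \<and> 0 \<le> ?t" by linarith
    qed
  qed
  then obtain C where "C > 0" "\<And>x. x \<in> closure \<Omega> \<Longrightarrow> ?P C x" by blast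
  then show ?thesis by (intro exI[of _ "1 / C"]) (auto simp: field_simps)
qed

section \<open>The Hessian of the modified defining function\<close>

definition outer :: "real ^ 'n \<Rightarrow> real ^ 'n \<Rightarrow> real ^ 'n ^ 'n" where
  "outer a b = (\<chi> i j. a $ i * b $ j)"

lemma outer_mult: "outer a b *v x = (b \<bullet> x) *\<^sub>R a"
  by (simp add: outer_def matrix_vector_mult_def inner_vec_def vec_eq_iff sum_distrib_left ac_simps)

context
  fixes \<Omega> :: "(real ^ 'n) set" and r \<phi> :: "real ^ 'n \<Rightarrow> real" and K \<eta> :: real
    and U V :: "(real ^ 'n) set"
  assumes \<Omega>: "open \<Omega>" and r: "smooth_on U r" "\<Omega> \<subseteq> U" and \<phi>: "smooth_on V \<phi>" "\<Omega> \<subseteq> V"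
    and neg: "\<And>x. x \<in> \<Omega> \<Longrightarrow> r x < 0"
begin

lemma powr_exp_form:
  "x \<in> \<Omega> \<Longrightarrow> - ((- r x * exp (- K * \<phi> x)) powr \<eta>) = - exp (\<eta> * (ln (- r x) - K * \<phi> x))"
  using neg[of x] ln_mult[of "- r x" "exp (- K * \<phi> x)"] by (simp add: powr_def)

lemma pd1_rho:
  assumes x: "x \<in> \<Omega>"
  shows "pd [j] (\<lambda>x. - ((- r x * exp (- K * \<phi> x)) powr \<eta>)) x =
    - (\<eta> * exp (\<eta> * (ln (- r x) - K * \<phi> x)) * (pd [j] r x / r x - K * pd [j] \<phi> x))"
proof -
  have Dr: "(r has_derivative (\<lambda>h. h \<bullet> grad r x)) (at x)"
    and Dp: "(\<phi> has_derivative (\<lambda>h. h \<bullet> grad \<phi> x)) (at x)"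
    using r \<phi> x by (auto intro!: smooth_on_has_derivative)
  have "((\<lambda>x. - exp (\<eta> * (ln (- r x) - K * \<phi> x))) has_derivative
     (\<lambda>h. - (\<eta> * exp (\<eta> * (ln (- r x) - K * \<phi> x)) * ((h \<bullet> grad r x) / r x - K * (h \<bullet> grad \<phi> x))))) (at x)"
    using neg[OF x]
    by (auto intro!: derivative_eq_intros Dr Dp simp: fun_eq_iff field_simps)
  \<comment> \<open>The exponential form is available on \<open>\<Omega>\<close> only; since
    \<open>\<Omega>\<close> is open, agreement there determines the derivative at \<open>x\<close>.
    The second derivatives below are transferred in the same way.\<close>
  then have "((\<lambda>x. - ((- r x * exp (- K * \<phi> x)) powr \<eta>)) has_derivative
     (\<lambda>h. - (\<eta> * exp (\<eta> * (ln (- r x) - K * \<phi> x)) * ((h \<bullet> grad r x) / r x - K * (h \<bullet> grad \<phi> x))))) (at x)"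
    by (rule has_derivative_transform_within_open[OF _ \<Omega> x]) (simp only: powr_exp_form)
  from pd_eqI[OF this] show ?thesis by (simp add: axis_inner_grad del: pd.simps)
qed

text \<open>\<open>G\<close> is the gradient of \<open>g\<close>.\<close>

lemma pd2_rho:
  assumes x: "x \<in> \<Omega>"
  defines "G \<equiv> grad r x /\<^sub>R r x - K *\<^sub>R grad \<phi> x"
  shows "pd [i, j] (\<lambda>x. - ((- r x * exp (- K * \<phi> x)) powr \<eta>)) x =
    - (\<eta> * exp (\<eta> * (ln (- r x) - K * \<phi> x)) *
       (\<eta> * (G $ i * G $ j) + pd [i, j] r x / r x
        - grad r x $ i * grad r x $ j / (r x)\<^sup>2 - K * pd [i, j] \<phi> x))"
proof -
  let ?E = "\<lambda>x. exp (\<eta> * (ln (- r x) - K * \<phi> x))"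
  let ?g = "\<lambda>x. pd [j] r x / r x - K * pd [j] \<phi> x"
  have Dr: "(r has_derivative (\<lambda>h. h \<bullet> grad r x)) (at x)"
    and Dp: "(\<phi> has_derivative (\<lambda>h. h \<bullet> grad \<phi> x)) (at x)"
    and Drj: "(pd [j] r has_derivative (\<lambda>h. h \<bullet> grad (pd [j] r) x)) (at x)"
    and Dpj: "(pd [j] \<phi> has_derivative (\<lambda>h. h \<bullet> grad (pd [j] \<phi>) x)) (at x)"
    using smooth_on_has_derivative[OF r(1)] smooth_on_has_derivative[OF \<phi>(1)]
      smooth_on_has_derivative[OF smooth_on_pd[OF r(1)]]
      smooth_on_has_derivative[OF smooth_on_pd[OF \<phi>(1)]] r(2) \<phi>(2) x by blast+
  have rx: "r x \<noteq> 0" using neg[OF x] by simp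
  have DE: "(?E has_derivative (\<lambda>h. \<eta> * ?E x * ((h \<bullet> grad r x) / r x - K * (h \<bullet> grad \<phi> x)))) (at x)"
    using neg[OF x]
    by (auto intro!: derivative_eq_intros Dr Dp simp: fun_eq_iff field_simps)
  have Dg: "(?g has_derivative (\<lambda>h. (h \<bullet> grad (pd [j] r) x) / r x
      - pd [j] r x * (h \<bullet> grad r x) / (r x)\<^sup>2 - K * (h \<bullet> grad (pd [j] \<phi>) x))) (at x)"
    using rx
    by (auto intro!: derivative_eq_intros Dr Drj Dpj simp del: pd.simps
        simp: fun_eq_iff field_simps power2_eq_square)
  have "((\<lambda>x. - (\<eta> * ?E x * ?g x)) has_derivative
      (\<lambda>h. - (\<eta> * ?E x * ((h \<bullet> grad (pd [j] r) x) / r x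
        - pd [j] r x * (h \<bullet> grad r x) / (r x)\<^sup>2 - K * (h \<bullet> grad (pd [j] \<phi>) x))
        + \<eta> * (\<eta> * ?E x * ((h \<bullet> grad r x) / r x - K * (h \<bullet> grad \<phi> x))) * ?g x))) (at x)"
    by (intro has_derivative_minus has_derivative_mult[of "\<lambda>x. \<eta> * ?E x"] has_derivative_mult_right DE Dg)
  then have "(pd [j] (\<lambda>x. - ((- r x * exp (- K * \<phi> x)) powr \<eta>)) has_derivative
      (\<lambda>h. - (\<eta> * ?E x * ((h \<bullet> grad (pd [j] r) x) / r x
        - pd [j] r x * (h \<bullet> grad r x) / (r x)\<^sup>2 - K * (h \<bullet> grad (pd [j] \<phi>) x))
        + \<eta> * (\<eta> * ?E x * ((h \<bullet> grad r x) / r x - K * (h \<bullet> grad \<phi> x))) * ?g x))) (at x)"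
    by (rule has_derivative_transform_within_open[OF _ \<Omega> x]) (simp only: pd1_rho)
  from pd_eqI[OF this, of i] show ?thesis
    unfolding pd_Cons2[of i j] axis_inner_grad G_def
    by (simp add: grad_def algebra_simps divide_inverse del: pd.simps)
qed

text \<open>\<open>outer G G\<close> comes from differentiating the exponential, the outer square of
  \<open>grad r\<close> from differentiating \<open>1 / r\<close>. Inside the bracket only the
  former carries a factor \<open>\<eta>\<close>.\<close>

lemma hessian_rho:
  assumes x: "x \<in> \<Omega>"
  defines "G \<equiv> grad r x /\<^sub>R r x - K *\<^sub>R grad \<phi> x"
  shows "hessian (\<lambda>x. - ((- r x * exp (- K * \<phi> x)) powr \<eta>)) x =
    (\<eta> * exp (\<eta> * (ln (- r x) - K * \<phi> x))) *\<^sub>R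
      (K *\<^sub>R hessian \<phi> x - hessian r x /\<^sub>R r x
       + outer (grad r x) (grad r x) /\<^sub>R (r x)\<^sup>2 - \<eta> *\<^sub>R outer G G)"
  unfolding vec_eq_iff hessian_def G_def vec_lambda_beta pd2_rho[OF x]
  by (simp add: outer_def algebra_simps divide_inverse del: pd.simps)

lemma transpose_hessian_rho:
  assumes x: "x \<in> \<Omega>"
  shows "transpose (hessian (\<lambda>x. - ((- r x * exp (- K * \<phi> x)) powr \<eta>)) x)
    = hessian (\<lambda>x. - ((- r x * exp (- K * \<phi> x)) powr \<eta>)) x"
proof -
  have "pd [i, j] r x = pd [j, i] r x" "pd [i, j] \<phi> x = pd [j, i] \<phi> x" for i j
    using r \<phi> x by (blast intro: pd_commute)+
  then show ?thesis
    unfolding vec_eq_iff transpose_def hessian_def vec_lambda_beta pd2_rho[OF x]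
    by (metis mult.commute)
qed

text \<open>The sign of \<open>r\<close> turns \<open>- 1 / r x\<close> into
  \<open>1 / \<bar>r x\<bar>\<close>, and the outer products become squares; the common factor in
  front is positive for \<open>\<eta> > 0\<close>.\<close>

lemma hessian_rho_quadratic:
  assumes x: "x \<in> \<Omega>"
  shows "e \<bullet> (hessian (\<lambda>x. - ((- r x * exp (- K * \<phi> x)) powr \<eta>)) x *v e) =
    \<eta> * exp (\<eta> * (ln (- r x) - K * \<phi> x)) *
      (K * (e \<bullet> (hessian \<phi> x *v e)) + (e \<bullet> (hessian r x *v e)) / \<bar>r x\<bar>
       + ((e \<bullet> grad r x) / r x)\<^sup>2 - \<eta> * ((e \<bullet> grad r x) / r x - K * (e \<bullet> grad \<phi> x))\<^sup>2)"
proof -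
  have "\<bar>r x\<bar> = - r x" using neg[OF x] by simp
  then show ?thesis
    unfolding hessian_rho[OF x]
    by (simp add: matrix_vector_mult_add_rdistrib matrix_vector_mult_diff_rdistrib outer_mult
        inner_add_right inner_diff_right inner_diff_left power_divide power2_eq_square
        inner_commute[of _ e] divide_inverse_commute flip: scaleR_matrix_vector_assoc)
qed

end

section \<open>Positivity of the trace and choice of constants\<close>

text \<open>The scalar core, applied with \<open>R = \<bar>r x\<bar>\<close>,
  \<open>s e = (e \<bullet> grad r x) / r x\<close>, \<open>t e = e \<bullet> grad \<phi> x\<close>,
  and with \<open>h\<close> and \<open>q\<close> the Hessian forms of \<open>\<phi>\<close> and
  \<open>r\<close>. No bound on \<open>s\<close> is available, since it may blow up at the
  boundary.\<close>

lemma rho_frame_trace_pos: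
  fixes a C D K \<eta> :: real
  assumes \<eta>: "0 < \<eta>" "\<eta> \<le> 1 / 4" "2 * \<eta> * K\<^sup>2 * D\<^sup>2 * card B < 1"
    and K: "K > 0" "C + card B * C\<^sup>2 / 2 + 1 \<le> K * a"
    and R: "R > 0"
    and h: "a \<le> (\<Sum>e\<in>B. h e)" and q: "- C * (R + (\<Sum>e\<in>B. \<bar>R * s e\<bar>)) \<le> (\<Sum>e\<in>B. q e)"
    and t: "\<And>e. e \<in> B \<Longrightarrow> \<bar>t e\<bar> \<le> D"
  shows "0 < (\<Sum>e\<in>B. K * h e + q e / R + (s e)\<^sup>2 - \<eta> * (s e - K * t e)\<^sup>2)"
proof -
  \<comment> \<open>With \<open>(u - v)^2 \<le> 2 u^2 + 2 v^2\<close>, the condition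
    \<open>\<eta> \<le> 1 / 4\<close> limits the loss in \<open>(s e)\<^sup>2\<close> to one half;
    the other half pays for \<open>C * \<bar>s e\<bar>\<close> at the price
    \<open>C\<^sup>2 / 2\<close>.\<close>
  have 1: "C * \<bar>s e\<bar> - C\<^sup>2 / 2 - 2 * \<eta> * K\<^sup>2 * D\<^sup>2 \<le> (s e)\<^sup>2 - \<eta> * (s e - K * t e)\<^sup>2"
    if "e \<in> B" for e
  proof -
    have "0 \<le> (s e + K * t e)\<^sup>2" by simp
    then have "(s e - K * t e)\<^sup>2 \<le> 2 * (s e)\<^sup>2 + 2 * (K\<^sup>2 * (t e)\<^sup>2)"
      by (simp add: power2_eq_square algebra_simps)
    also have "\<dots> \<le> 2 * (s e)\<^sup>2 + 2 * (K\<^sup>2 * D\<^sup>2)"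
      using t[OF that] by (intro add_left_mono mult_left_mono) (auto simp: abs_le_square_iff[symmetric])
    finally have "\<eta> * (s e - K * t e)\<^sup>2 \<le> \<eta> * (2 * (s e)\<^sup>2 + 2 * (K\<^sup>2 * D\<^sup>2))"
      using \<eta> by (intro mult_left_mono) auto
    moreover have "\<eta> * (s e)\<^sup>2 \<le> 1 / 4 * (s e)\<^sup>2" using \<eta> by (intro mult_right_mono) auto
    moreover have "0 \<le> (\<bar>s e\<bar> - C)\<^sup>2" by simp
    then have "C * \<bar>s e\<bar> \<le> (s e)\<^sup>2 / 2 + C\<^sup>2 / 2"
      by (simp add: power2_diff mult.commute mult.left_commute)
    ultimately show ?thesis by (simp add: algebra_simps)
  qed
  let ?S = "\<Sum>e\<in>B. \<bar>s e\<bar>"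
  have "(\<Sum>e\<in>B. C * \<bar>s e\<bar> - C\<^sup>2 / 2 - 2 * \<eta> * K\<^sup>2 * D\<^sup>2)
      \<le> (\<Sum>e\<in>B. (s e)\<^sup>2 - \<eta> * (s e - K * t e)\<^sup>2)"
    using 1 by (rule sum_mono)
  then have A: "C * ?S - card B * (C\<^sup>2 / 2) - card B * (2 * \<eta> * K\<^sup>2 * D\<^sup>2)
      \<le> (\<Sum>e\<in>B. (s e)\<^sup>2 - \<eta> * (s e - K * t e)\<^sup>2)"
    by (simp add: sum_subtractf sum_distrib_left)
  have "(\<Sum>e\<in>B. \<bar>R * s e\<bar>) = R * ?S" using R by (simp add: abs_mult sum_distrib_left)
  \<comment> \<open>Division by \<open>R\<close> makes the first error the constant \<open>C\<close>
    and the second exactly the linear term gained in \<open>A\<close>.\<close>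
  then have "- C * (R + R * ?S) / R \<le> (\<Sum>e\<in>B. q e) / R"
    using q R by (intro divide_right_mono) auto
  moreover have "- C * (R + R * ?S) / R = - C - C * ?S" using R by (simp add: field_simps)
  ultimately have B: "- C - C * ?S \<le> (\<Sum>e\<in>B. q e / R)" by (simp add: sum_divide_distrib)
  have "K * a \<le> (\<Sum>e\<in>B. K * h e)"
    using h K(1) by (simp flip: sum_distrib_left)
  then have "K * a - C - card B * (C\<^sup>2 / 2) - card B * (2 * \<eta> * K\<^sup>2 * D\<^sup>2)
     \<le> (\<Sum>e\<in>B. K * h e) + (\<Sum>e\<in>B. q e / R) + (\<Sum>e\<in>B. (s e)\<^sup>2 - \<eta> * (s e - K * t e)\<^sup>2)"
    using A B by linarith
  also have "\<dots> = (\<Sum>e\<in>B. K * h e + q e / R + (s e)\<^sup>2 - \<eta> * (s e - K * t e)\<^sup>2)"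
    by (simp add: sum.distrib sum_subtractf)
  \<comment> \<open>The bound on \<open>K * a\<close> leaves at least \<open>1\<close>, and the
    remaining loss, caused by \<open>t\<close>, is below \<open>1\<close> by the condition on
    \<open>\<eta>\<close>.\<close>
  finally show ?thesis using K(2) \<eta>(3) by (simp add: algebra_simps)
qed

theorem theorem2p1:
  fixes \<Omega> :: "(real ^ 'n) set" and r :: "real ^ 'n \<Rightarrow> real" and p :: nat
  assumes "bounded \<Omega>" and "open \<Omega>"
    and "1 \<le> p" and "p \<le> CARD('n)"
    and "smooth_on_closure \<Omega> r" and "defining_function \<Omega> r"
    and "p_convex_boundary p \<Omega> r"
  shows "\<forall>\<phi>. smooth_on_closure \<Omega> \<phi> \<and> strictly_p_psh_on p (closure \<Omega>) \<phi> \<longrightarrow>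
           (\<exists>K::real. \<exists>\<eta>0::real. K > 0 \<and> 0 < \<eta>0 \<and> \<eta>0 < 1 \<and>
              (\<forall>\<eta>. 0 < \<eta> \<and> \<eta> < \<eta>0 \<longrightarrow>
                 strictly_p_psh_on p \<Omega> (\<lambda>x. - ((- r x * exp (- K * \<phi> x)) powr \<eta>))))"
proof (intro allI impI, elim conjE)
  fix \<phi> :: "real ^ 'n \<Rightarrow> real"
  assume \<phi>: "smooth_on_closure \<Omega> \<phi>" "strictly_p_psh_on p (closure \<Omega>) \<phi>"
  obtain U where U: "smooth_on U r" "\<Omega> \<subseteq> U"
    using assms(5) closure_subset by (fastforce simp: smooth_on_closure_def)
  obtain V where V: "smooth_on V \<phi>" "closure \<Omega> \<subseteq> V"
    using \<phi>(1) by (auto simp: smooth_on_closure_def)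
  then have V': "\<Omega> \<subseteq> V" using closure_subset by blast
  have neg: "r x < 0" if "x \<in> \<Omega>" for x using assms(6) that by (simp add: defining_function_def)
  obtain C where C: "C > 0" "\<And>x B. x \<in> \<Omega> \<Longrightarrow> orthonormal_frame p B \<Longrightarrow>
    - C * (\<bar>r x\<bar> + (\<Sum>e\<in>B. \<bar>e \<bullet> grad r x\<bar>)) \<le> (\<Sum>e\<in>B. e \<bullet> (hessian r x *v e))"
    using hessian_estimate[OF assms(1,2,5-7)] by blast
  obtain a where a: "a > 0" "\<And>x B. x \<in> \<Omega> \<Longrightarrow> orthonormal_frame p B \<Longrightarrow>
      a \<le> (\<Sum>e\<in>B. e \<bullet> (hessian \<phi> x *v e))"
    using strictly_p_psh_uniform[OF assms(1) \<phi>] closure_subset by blast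
  have "bounded (grad \<phi> ` closure \<Omega>)"
    using assms(1) V
    by (intro compact_imp_bounded compact_continuous_image continuous_on_grad)
       (auto simp: compact_closure)
  then obtain D where D: "D > 0" "\<And>x. x \<in> \<Omega> \<Longrightarrow> norm (grad \<phi> x) \<le> D"
    unfolding bounded_pos using closure_subset by (metis image_eqI subsetD)
  \<comment> \<open>Makes \<open>K * a\<close> exactly the amount that
    \<open>rho_frame_trace_pos\<close> demands.\<close>
  define K where "K = (C + real p * C\<^sup>2 / 2 + 1) / a"
  \<comment> \<open>\<open>\<eta> * Y\<close> bounds the total loss caused by
    \<open>grad \<phi>\<close> on \<open>p\<close> vectors. In \<open>\<eta>0\<close> the
    \<open>4\<close> yields \<open>\<eta>0 \<le> 1 / 4\<close> and the \<open>Y\<close> yields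
    \<open>\<eta>0 * Y < 1\<close>.\<close>
  define Y where "Y = 2 * K\<^sup>2 * D\<^sup>2 * real p"
  define \<eta>0 where "\<eta>0 = 1 / (Y + 4)"
  have K: "K > 0" "C + real p * C\<^sup>2 / 2 + 1 \<le> K * a"
    using a C by (auto simp: K_def intro!: divide_pos_pos add_pos_nonneg)
  have Y: "0 \<le> Y" by (simp add: Y_def)
  then have \<eta>0: "0 < \<eta>0" "\<eta>0 \<le> 1 / 4" "\<eta>0 * Y < 1"
    by (simp_all add: \<eta>0_def field_simps)
  have "strictly_p_psh_on p \<Omega> (\<lambda>x. - ((- r x * exp (- K * \<phi> x)) powr \<eta>))"
    if \<eta>: "0 < \<eta>" "\<eta> < \<eta>0" for \<eta>
    unfolding strictly_p_psh_on_def
  proof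
    fix x assume x: "x \<in> \<Omega>"
    show "p_pos_def p (hessian (\<lambda>x. - ((- r x * exp (- K * \<phi> x)) powr \<eta>)) x)"
    proof (rule p_pos_defI_frame_trace)
      show "transpose (hessian (\<lambda>x. - ((- r x * exp (- K * \<phi> x)) powr \<eta>)) x)
          = hessian (\<lambda>x. - ((- r x * exp (- K * \<phi> x)) powr \<eta>)) x"
        using assms(2) U V(1) V' neg x by (rule transpose_hessian_rho)
    next
      fix B :: "(real ^ 'n) set" assume B: "orthonormal_frame p B"
      note F = orthonormal_frameD[OF B]
      have "0 < (\<Sum>e\<in>B. K * (e \<bullet> (hessian \<phi> x *v e)) + (e \<bullet> (hessian r x *v e)) / \<bar>r x\<bar>
       + ((e \<bullet> grad r x) / r x)\<^sup>2 - \<eta> * ((e \<bullet> grad r x) / r x - K * (e \<bullet> grad \<phi> x))\<^sup>2)"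
      proof (rule rho_frame_trace_pos)
        show "0 < \<eta>" "\<eta> \<le> 1 / 4" using \<eta> \<eta>0 by auto
        have "2 * \<eta> * K\<^sup>2 * D\<^sup>2 * real (card B) = \<eta> * Y"
          using F(2) by (simp add: Y_def)
        also have "\<dots> \<le> \<eta>0 * Y" using \<eta>(2) Y by (intro mult_right_mono) auto
        finally show "2 * \<eta> * K\<^sup>2 * D\<^sup>2 * real (card B) < 1" using \<eta>0(3) by linarith
        show "C + real (card B) * C\<^sup>2 / 2 + 1 \<le> K * a" using K(2) F(2) by simp
        show "0 < \<bar>r x\<bar>" using neg[OF x] by simp
        then have "\<bar>\<bar>r x\<bar> * ((e \<bullet> grad r x) / r x)\<bar> = \<bar>e \<bullet> grad r x\<bar>" for e
          by (simp add: abs_mult)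
        then show "- C * (\<bar>r x\<bar> + (\<Sum>e\<in>B. \<bar>\<bar>r x\<bar> * ((e \<bullet> grad r x) / r x)\<bar>))
            \<le> (\<Sum>e\<in>B. e \<bullet> (hessian r x *v e))"
          using C(2)[OF x B] by simp
        show "\<bar>e \<bullet> grad \<phi> x\<bar> \<le> D" if "e \<in> B" for e
          using Cauchy_Schwarz_ineq2[of e "grad \<phi> x"] F(3)[OF that] D(2)[OF x] by simp
      qed (use K a x B in auto)
      then show "0 < (\<Sum>e\<in>B. e \<bullet> (hessian (\<lambda>x. - ((- r x * exp (- K * \<phi> x)) powr \<eta>)) x *v e))"
        using \<eta>(1)
        by (simp only: hessian_rho_quadratic[OF assms(2) U V(1) V' neg x] flip: sum_distrib_left)
           simp
    qed
  qed
  then show "\<exists>K::real. \<exists>\<eta>0::real. K > 0 \<and> 0 < \<eta>0 \<and> \<eta>0 < 1 \<and>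
      (\<forall>\<eta>. 0 < \<eta> \<and> \<eta> < \<eta>0 \<longrightarrow>
        strictly_p_psh_on p \<Omega> (\<lambda>x. - ((- r x * exp (- K * \<phi> x)) powr \<eta>)))"
    using K(1) \<eta>0(1,2) by (intro exI[of _ K] exI[of _ \<eta>0]) auto
qed

end
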